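(* Let $\omega\in\mathbb{R}^n$ be generic and $\beta\subseteq[n]$. If $\mathrm{in}_\omega(I_{\mathcal C_{\mathcal A}})$ has a circuit-specific standard pair of type $\beta$, then $I_{\mathcal C_{\mathcal A}}$ has an embedded prime $P_\sigma+I_{\mathcal A}$ for some face $\sigma$ of $\mathrm{cone}(\mathcal A)$ such that $\sigma\supseteq\beta$.
   Context: Setting: $\mathcal A=\{\mathbf a_1,\dots,\mathbf a_n\}\subset\mathbb{Z}^d$ is an ordered vector configuration such that the $d\times n$ matrix $A=[\mathbf a_1\cdots\mathbf a_n]$ has rank $d$; $\mathcal L_{\mathcal A}=\{\mathbf u\in\mathbb{Z}^n: A\mathbf u=\mathbf 0\}$, and it is assumed that $\mathcal L_{\mathcal A}\cap\mathbb{N}^n=\{\mathbf 0\}$ ($\mathbb N$ contains $0$). $\mathbf k$ is an algebraically closed field, $\mathbf k[\mathbf x]=\mathbf k[x_1,\dots,x_n]$, $[n]=\{1,\dots,n\}$. For $\mathbf u\in\mathbb{Z}^n$: $\mathrm{supp}(\mathbf u)=\{i:u_i\ne0\}$, $\mathbf u^+_i=\max(u_i,0)$, $\mathbf u^-_i=\max(-u_i,0)$. Circuit: a non-zero vector $\mathbf c\in\mathcal L_{\mathcal A}$ whose entries have greatest common divisor one and such that no non-zero $\mathbf d\in\mathcal L_{\mathcal A}$ has $\mathrm{supp}(\mathbf d)\subsetneq\mathrm{supp}(\mathbf c)$. Circuit ideal: $I_{\mathcal C_{\mathcal A}}=\langle\mathbf x^{\mathbf c^+}-\mathbf x^{\mathbf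 c^-}:\mathbf c\text{ a circuit}\rangle$. Toric ideal: $I_{\mathcal A}=\langle\mathbf x^{\mathbf u^+}-\mathbf x^{\mathbf u^-}:\mathbf u\in\mathcal L_{\mathcal A}\rangle$. Faces: $\mathrm{cone}(\mathcal A)$ is the $d$-dimensional cone spanned by $\mathcal A$ in $\mathbb{R}^d$. A face $F$ of $\mathrm{cone}(\mathcal A)$ is recorded as the index set $\{j\in[n]:\mathbf a_j\in F\}$. For $\sigma\subseteq[n]$, $P_\sigma=\langle x_j:j\notin\sigma\rangle$. Initial ideals: for $\omega\in\mathbb{R}^n$, $\mathrm{in}_\omega(f)$ is the sum of the terms $c\,\mathbf x^{\mathbf u}$ of $f$ with $\omega\cdot\mathbf u$ maximal, and $\mathrm{in}_\omega(I)=\langle\mathrm{in}_\omega(f):f\in I\rangle$. $\omega$ is generic if $\mathrm{in}_\omega(I_{\mathcal A})$ and $\mathrm{in}_\omega(I_{\mathcal C_{\mathcal A}})$ are both monomial ideals. Standard pairs: a standard monomial of a monomial ideal $M$ is a monomial not in $M$. For a standard monomial $\mathbf x^{\mathbf u}$ and $\sigma\subseteq[n]$, $(\mathbf x^{\mathbf u},\sigma)$ is an admissible pair of $M$ if $\mathrm{supp}(\mathbf u)\cap\sigma=\emptyset$ and all monomials in $\mathbf x^{\mathbf u}\cdot\mathbf k[x_j:j\in\sigma]$ are standard. It is a standard pair if there is no other admissible pair $(\mathbf x^{\mathbf v},\tau)$ with $\mathbf v\le\mathbf u$ and $\mathrm{supp}(\mathbf u-\mathbf v)\cup\sigma\subseteq\tau$.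 The type of $(\mathbf x^{\mathbf u},\sigma)$ is $\sigma$. A circuit-specific standard pair (CSP) of $\mathrm{in}_\omega(I_{\mathcal C_{\mathcal A}})$ is a standard pair of $\mathrm{in}_\omega(I_{\mathcal C_{\mathcal A}})$ that is not a standard pair of $\mathrm{in}_\omega(I_{\mathcal A})$. *)

theory Defs
  imports
    "HOL-Analysis.Analysis"
    "HOL-Library.Poly_Mapping"
    "HOL-Algebra.Algebraic_Closure_Type"
    "HOL-Computational_Algebra.Polynomial"
begin

section \<open>Vector configurations\<close>

text \<open>
  A configuration \<open>a\<^sub>1, \<dots>, a\<^sub>n\<close> in \<open>\<int>\<^sup>d\<close> is given by the \<open>d \<times> n\<close> matrix with these columns;
  the index set \<open>[n]\<close> is the finite type \<open>'n\<close>, and \<open>\<int>\<^sup>d\<close> is \<open>int ^ 'd\<close>.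
\<close>

definition real_mat :: "int ^ 'n ^ 'd \<Rightarrow> real ^ 'n ^ 'd" where
  "real_mat A = map_matrix real_of_int A"

definition ker_lattice :: "int ^ 'n ^ 'd \<Rightarrow> (int ^ 'n) set" where
  "ker_lattice A = {u. A *v u = 0}"

definition supp :: "'a::zero ^ 'n \<Rightarrow> 'n set" where
  "supp u = {i. u $ i \<noteq> 0}"

definition pos_part :: "int ^ 'n \<Rightarrow> nat ^ 'n" where
  "pos_part u = (\<chi> i. nat (max (u $ i) 0))"

definition neg_part :: "int ^ 'n \<Rightarrow> nat ^ 'n" where
  "neg_part u = (\<chi> i. nat (max (- u $ i) 0))"

definition circuit :: "int ^ 'n ^ 'd \<Rightarrow> int ^ 'n \<Rightarrow> bool" where
  "circuit A c \<longleftrightarrow> c \<in> ker_lattice A \<and> c \<noteq> 0 \<and> Gcd (range (\<lambda>i. c $ i)) = 1 \<and>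
     \<not> (\<exists>d \<in> ker_lattice A. d \<noteq> 0 \<and> supp d \<subset> supp c)"

definition cone_of :: "int ^ 'n ^ 'd \<Rightarrow> (real ^ 'd) set" where
  "cone_of A = convex_cone hull (columns (real_mat A))"

text \<open>
  Faces are recorded by index sets. A face in the sense of the library may be empty; the faces
  of a cone are the nonempty ones.
\<close>

definition cone_face :: "int ^ 'n ^ 'd \<Rightarrow> 'n set \<Rightarrow> bool" where
  "cone_face A \<sigma> \<longleftrightarrow>
     (\<exists>F. F face_of cone_of A \<and> F \<noteq> {} \<and> \<sigma> = {j. column j (real_mat A) \<in> F})"


section \<open>Polynomials and ideals\<close>

text \<open>
  The polynomial ring over \<open>'k\<close> in the variables \<open>x\<^sub>i\<close>, \<open>i :: 'n\<close>, is the monoid algebra of the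
  monoid of exponent vectors \<open>nat ^ 'n\<close>.
\<close>

type_synonym ('n, 'k) mpol = "(nat ^ 'n) \<Rightarrow>\<^sub>0 'k"

abbreviation pring :: "('n::finite, 'k::field) mpol ring" where
  "pring \<equiv> ring_of_type_algebra"

definition xpow :: "nat ^ 'n \<Rightarrow> ('n::finite, 'k::field) mpol" where
  "xpow u = Poly_Mapping.single u 1"

definition circuit_ideal :: "int ^ 'n ^ 'd \<Rightarrow> ('n::finite, 'k::field) mpol set" where
  "circuit_ideal A = Idl\<^bsub>pring\<^esub> {xpow (pos_part c) - xpow (neg_part c) | c. circuit A c}"

definition toric_ideal :: "int ^ 'n ^ 'd \<Rightarrow> ('n::finite, 'k::field) mpol set" where
  "toric_ideal A = Idl\<^bsub>pring\<^esub> {xpow (pos_part u) - xpow (neg_part u) | u. u \<in> ker_lattice A}"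

definition var_prime :: "'n set \<Rightarrow> ('n::finite, 'k::field) mpol set" where
  "var_prime \<sigma> = Idl\<^bsub>pring\<^esub> {xpow (axis j 1) | j. j \<notin> \<sigma>}"

definition associated_prime :: "('a, 'b) ring_scheme \<Rightarrow> 'a set \<Rightarrow> 'a set \<Rightarrow> bool" where
  "associated_prime R I P \<longleftrightarrow> primeideal P R \<and>
     (\<exists>f \<in> carrier R. P = {g \<in> carrier R. g \<otimes>\<^bsub>R\<^esub> f \<in> I})"

definition embedded_prime :: "('a, 'b) ring_scheme \<Rightarrow> 'a set \<Rightarrow> 'a set \<Rightarrow> bool" where
  "embedded_prime R I P \<longleftrightarrow> associated_prime R I P \<and> (\<exists>Q. associated_prime R I Q \<and> Q \<subset> P)"


section \<open>Initial ideals\<close>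

definition weight :: "real ^ 'n \<Rightarrow> nat ^ 'n \<Rightarrow> real" where
  "weight \<omega> u = (\<Sum>i\<in>UNIV. \<omega> $ i * real (u $ i))"

definition initial_form :: "real ^ 'n \<Rightarrow> ('n::finite, 'k::field) mpol \<Rightarrow> ('n, 'k) mpol" where
  "initial_form \<omega> f =
     (\<Sum>u | u \<in> Poly_Mapping.keys f \<and> (\<forall>v \<in> Poly_Mapping.keys f. weight \<omega> v \<le> weight \<omega> u).
        Poly_Mapping.single u (Poly_Mapping.lookup f u))"

definition initial_ideal ::
  "real ^ 'n \<Rightarrow> ('n::finite, 'k::field) mpol set \<Rightarrow> ('n, 'k) mpol set" where
  "initial_ideal \<omega> I = Idl\<^bsub>pring\<^esub> (initial_form \<omega> ` I)"

definition monomial_ideal :: "('n::finite, 'k::field) mpol set \<Rightarrow> bool" where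
  "monomial_ideal M \<longleftrightarrow> (\<exists>S. M = Idl\<^bsub>pring\<^esub> (xpow ` S))"

text \<open>The type argument of the next definition (and of \<open>csp\<close> below) is the coefficient field.\<close>

definition generic_weight :: "'k::field itself \<Rightarrow> int ^ 'n ^ 'd \<Rightarrow> real ^ 'n \<Rightarrow> bool" where
  "generic_weight _ A \<omega> \<longleftrightarrow>
     monomial_ideal (initial_ideal \<omega> (toric_ideal A :: ('n, 'k) mpol set)) \<and>
     monomial_ideal (initial_ideal \<omega> (circuit_ideal A :: ('n, 'k) mpol set))"


section \<open>Standard pairs\<close>

text \<open>A monomial is represented by its exponent vector. The order on \<open>nat ^ 'n\<close> is componentwise.\<close>

definition standard_monomial :: "('n::finite, 'k::field) mpol set \<Rightarrow> nat ^ 'n \<Rightarrow> bool" where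
  "standard_monomial M u \<longleftrightarrow> xpow u \<notin> M"

definition admissible_pair ::
  "('n::finite, 'k::field) mpol set \<Rightarrow> nat ^ 'n \<Rightarrow> 'n set \<Rightarrow> bool" where
  "admissible_pair M u \<sigma> \<longleftrightarrow> standard_monomial M u \<and> supp u \<inter> \<sigma> = {} \<and>
     (\<forall>w. supp w \<subseteq> \<sigma> \<longrightarrow> standard_monomial M (u + w))"

definition standard_pair ::
  "('n::finite, 'k::field) mpol set \<Rightarrow> nat ^ 'n \<Rightarrow> 'n set \<Rightarrow> bool" where
  "standard_pair M u \<sigma> \<longleftrightarrow> admissible_pair M u \<sigma> \<and>
     \<not> (\<exists>v \<tau>. (v, \<tau>) \<noteq> (u, \<sigma>) \<and> admissible_pair M v \<tau> \<and> v \<le> u \<and> supp (u - v) \<union> \<sigma> \<subseteq> \<tau>)"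

definition csp ::
  "'k::field itself \<Rightarrow> int ^ 'n ^ 'd \<Rightarrow> real ^ 'n \<Rightarrow> nat ^ 'n \<Rightarrow> 'n set \<Rightarrow> bool" where
  "csp _ A \<omega> u \<sigma> \<longleftrightarrow>
     standard_pair (initial_ideal \<omega> (circuit_ideal A :: ('n, 'k) mpol set)) u \<sigma> \<and>
     \<not> standard_pair (initial_ideal \<omega> (toric_ideal A :: ('n, 'k) mpol set)) u \<sigma>"

end

theory Submission
  imports Defs
begin

text \<open>
  Write \<open>I\<close> for the circuit ideal, \<open>T\<close> for the toric ideal and \<open>J\<close> for the saturation of \<open>I\<close> by
  the variables with index in \<open>\<beta>\<close>. The proof produces a polynomial \<open>f\<close> in \<open>T\<close> whose annihilator modulo
  \<open>I\<close> is \<open>P\<^sub>\<sigma> + T\<close> for a proper face \<open>\<sigma>\<close> containing \<open>\<beta>\<close>.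

  A circuit-specific standard pair of type \<open>\<beta>\<close> forces \<open>T\<close> not to be contained in \<open>J\<close>
  (\<open>toric_ideal_not_in_saturation_if_csp\<close>): otherwise a monomial in the initial ideal of \<open>T\<close> would
  lie in that of \<open>I\<close> after multiplication by a monomial in the variables of \<open>\<beta>\<close>, and standard pairs of
  type \<open>\<beta>\<close> do not see such factors.

  Both ideals are graded by \<open>\<int>\<^sup>d\<close>, so there are homogeneous elements of \<open>T\<close> outside \<open>J\<close>. One that
  is killed modulo \<open>J\<close> by as many variables as possible has annihilator \<open>P\<^sub>\<sigma> + T\<close> modulo \<open>J\<close>, where
  \<open>\<sigma>\<close> consists of the variables that do not kill it (\<open>ex_saturated_colon_eq_face_prime\<close>). Two facts
  about circuits enter here. Circuits generate the integer lattice of relations on every index set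
  (\<open>circuits_generate_ker_lattice\<close>), so \<open>I\<close> contains all lattice binomials on \<open>\<sigma>\<close> up to monomial
  factors on \<open>\<sigma>\<close>. And every real relation among the columns has, for each coordinate in its support, a
  circuit through that coordinate with compatible signs (\<open>conformal_circuit\<close>), so that \<open>\<sigma>\<close> is a
  face as soon as no circuit has its positive part but not its negative part inside \<open>\<sigma>\<close>
  (\<open>circuit_closed_imp_cone_face\<close>).

  The ideal \<open>P\<^sub>\<sigma> + T\<close> is the kernel of a homomorphism to the group algebra of \<open>\<int>\<^sup>d\<close>, which is a
  domain (\<open>face_prime_is_prime\<close>). It is finitely generated by variables and the binomials of the Graver
  basis, so replacing \<open>f\<close> by a monomial multiple turns its annihilator modulo \<open>J\<close> into one modulo
  \<open>I\<close> (\<open>ex_uniform_exponent_face_prime\<close>). The same device shows that \<open>T\<close>, the case of the full index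
  set, is an associated prime of \<open>I\<close>. It is strictly smaller, since \<open>\<sigma>\<close> is a proper subset and \<open>T\<close> contains
  no variable; hence \<open>P\<^sub>\<sigma> + T\<close> is embedded.
\<close>

(* The dollar sign is reserved for coordinates of vectors, and primes are those of \<open>nat\<close> and \<open>int\<close>. *)
no_notation fps_nth (infixl "$" 75)
hide_const (open) Divisibility.prime

section \<open>Circuits and the lattice of relations\<close>

lemma mult_vec_component: "(M *v x) $ i = (\<Sum>j\<in>UNIV. M $ i $ j * x $ j)"
  by (simp add: matrix_vector_mult_def)

lemma ker_lattice_iff:
  "u \<in> ker_lattice A \<longleftrightarrow> (\<forall>i. (\<Sum>j\<in>UNIV. A $ i $ j * u $ j) = 0)"
  by (simp add: ker_lattice_def vec_eq_iff mult_vec_component)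

lemma zero_in_ker_lattice [simp]: "0 \<in> ker_lattice A"
  by (simp add: ker_lattice_iff)

lemma ker_lattice_lincomb:
  assumes "u \<in> ker_lattice A" "v \<in> ker_lattice A"
  shows "a *s u - b *s v \<in> ker_lattice A"
proof -
  have "(\<Sum>j\<in>UNIV. A $ i $ j * (a *s u - b *s v) $ j)
      = a * (\<Sum>j\<in>UNIV. A $ i $ j * u $ j) - b * (\<Sum>j\<in>UNIV. A $ i $ j * v $ j)" for i
    by (simp add: sum_distrib_left sum_subtractf [symmetric] algebra_simps)
  then show ?thesis
    using assms by (simp add: ker_lattice_iff)
qed

lemma ker_lattice_diff:
  "u \<in> ker_lattice A \<Longrightarrow> v \<in> ker_lattice A \<Longrightarrow> u - v \<in> ker_lattice A"
  using ker_lattice_lincomb [of u A v 1 1] by simp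

lemma ker_lattice_uminus: "u \<in> ker_lattice A \<Longrightarrow> - u \<in> ker_lattice A"
  using ker_lattice_diff [of 0 A u] by simp

lemma supp_uminus [simp]: "supp (- u :: int ^ 'n) = supp u"
  by (simp add: supp_def)

lemma circuit_uminus: "circuit A c \<Longrightarrow> circuit A (- c)"
proof -
  assume c: "circuit A c"
  have "Gcd (range (\<lambda>i. (- c) $ i)) = Gcd (range (\<lambda>i. c $ i))"
  proof -
    have "range (\<lambda>i. (- c) $ i) = (*) (- 1) ` range (\<lambda>i. c $ i)" by auto
    then show ?thesis by (simp only: Gcd_mult) simp
  qed
  with c show ?thesis
    by (auto simp: circuit_def ker_lattice_uminus)
qed

text \<open>
  A nonzero lattice vector of minimal support below the given one becomes a circuit once it is
  divided by the gcd of its entries.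
\<close>
lemma circuit_within_support:
  assumes "u \<in> ker_lattice A" "u \<noteq> 0"
  obtains d where "circuit A d" "supp d \<subseteq> supp u"
proof -
  let ?P = "\<lambda>w. w \<in> ker_lattice A \<and> w \<noteq> 0 \<and> supp w \<subseteq> supp u"
  have "?P u" using assms by simp
  then obtain w where w: "?P w" and least: "\<And>y. ?P y \<Longrightarrow> card (supp w) \<le> card (supp y)"
    using ex_has_least_nat [of ?P u "\<lambda>w. card (supp w)"] by blast
  define g where "g = Gcd (range (\<lambda>i. w $ i))"
  from w obtain k where k: "w $ k \<noteq> 0" by (auto simp: vec_eq_iff)
  have g0: "g \<noteq> 0" using k by (auto simp: g_def)
  have gpos: "g > 0" using g0 by (simp add: g_def order.not_eq_order_implies_strict)
  define d where "d = (\<chi> i. w $ i div g)"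
  have gd: "w $ i = g * d $ i" for i
    by (simp add: d_def g_def)
  have "range (\<lambda>i. w $ i) = (*) g ` range (\<lambda>i. d $ i)"
    by (auto simp: gd)
  then have "g = \<bar>g * Gcd (range (\<lambda>i. d $ i))\<bar>"
    by (metis g_def Gcd_mult normalize_int_def abs_mult sgn_mult abs_sgn)
  then have gcd1: "Gcd (range (\<lambda>i. d $ i)) = 1"
    using gpos by (simp add: abs_mult)
  have supp_d: "supp d = supp w"
    using g0 by (auto simp: supp_def gd)
  have dker: "d \<in> ker_lattice A"
  proof -
    have "g * (\<Sum>j\<in>UNIV. A $ i $ j * d $ j) = (\<Sum>j\<in>UNIV. A $ i $ j * w $ j)" for i
      by (simp add: gd sum_distrib_left algebra_simps)
    then show ?thesis using w g0 by (simp add: ker_lattice_iff) 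
  qed
  have "circuit A d"
    unfolding circuit_def
  proof (intro conjI notI)
    show "d = 0 \<Longrightarrow> False" using k gd by simp
    assume "\<exists>e\<in>ker_lattice A. e \<noteq> 0 \<and> supp e \<subset> supp d"
    then obtain e where e: "e \<in> ker_lattice A" "e \<noteq> 0" "supp e \<subset> supp w"
      by (auto simp: supp_d)
    then have "card (supp e) < card (supp w)"
      by (intro psubset_card_mono) auto
    moreover have "?P e" using e w by auto
    ultimately show False using least [of e] by simp
  qed (use dker gcd1 in auto)
  then show ?thesis using that supp_d w by auto
qed

text \<open>
  The least positive element generates the subgroup, so it would have a prime factor dividing
  everything if it were not one.
\<close>
lemma int_subgroup_contains_one:
  assumes diff: "\<And>x y. x \<in> D \<Longrightarrow> y \<in> D \<Longrightarrow> x - y \<in> D"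
    and primes: "\<And>p::int. prime p \<Longrightarrow> \<exists>n\<in>D. \<not> p dvd n"
  shows "1 \<in> D"
proof -
  obtain a where a: "a \<in> D" "\<not> 2 dvd a" using primes [of 2] by auto
  have zero: "0 \<in> D" using diff [OF a(1) a(1)] by simp
  have neg: "- x \<in> D" if "x \<in> D" for x using diff [OF zero that] by simp
  have add: "x + y \<in> D" if "x \<in> D" "y \<in> D" for x y using diff [OF that(1) neg [OF that(2)]] by simp
  have nmult: "int k * x \<in> D" if "x \<in> D" for x k
    by (induction k) (use zero add that in \<open>auto simp: algebra_simps\<close>)
  have mult: "z * x \<in> D" if "x \<in> D" for x z
    using nmult [OF that, of "nat \<bar>z\<bar>"] neg by (cases "z \<ge> 0") fastforce+
  have "nat \<bar>a\<bar> > 0 \<and> int (nat \<bar>a\<bar>) \<in> D" using a neg [of a] by (cases "a = 0") (auto simp: abs_if)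
  then obtain n :: nat where n: "n > 0" "int n \<in> D"
    and least: "\<And>m. m > 0 \<Longrightarrow> int m \<in> D \<Longrightarrow> n \<le> m"
    using exists_least_iff [of "\<lambda>n. n > 0 \<and> int n \<in> D"] by (metis not_less)
  have "n = 1"
  proof (rule ccontr)
    assume "n \<noteq> 1"
    then obtain p where p: "prime p" "p dvd n" using prime_factor_nat by blast
    then obtain m where m: "m \<in> D" "\<not> int p dvd m" using primes [of "int p"] by auto
    have "m mod int n = m - (m div int n) * int n" by (simp add: minus_div_mult_eq_mod)
    then have inD: "m mod int n \<in> D" using diff [OF m(1) mult [OF n(2)]] by simp
    have "m mod int n \<noteq> 0" using m p by (metis dvd_trans int_dvd_int_iff mod_0_imp_dvd)
    then have pos: "m mod int n > 0" using n(1) by (simp add: order.not_eq_order_implies_strict)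
    have "n \<le> nat (m mod int n)" using least [of "nat (m mod int n)"] inD pos by simp
    moreover have "m mod int n < int n" using n(1) by simp
    ultimately show False using pos by linarith
  qed
  with n show ?thesis by simp
qed

text \<open>
  The circuits inside a support generate all lattice vectors with that support over the integers,
  not just over the rationals. By \<open>int_subgroup_contains_one\<close> this can be checked one prime \<open>p\<close> at a time: it
  suffices that some multiple \<open>n u\<close> with \<open>p\<close> not dividing \<open>n\<close> is generated. A circuit \<open>d\<close> below \<open>u\<close> is
  primitive, so \<open>p\<close> does not divide some \<open>d\<^sub>j\<close>, and \<open>d\<^sub>j u - u\<^sub>j d\<close> has smaller support than \<open>u\<close>.
\<close>
lemma circuits_generate_ker_lattice:
  fixes A :: "int ^ 'n ^ 'd" and G :: "(int ^ 'n) set"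
  assumes zero: "0 \<in> G"
    and diff: "\<And>x y. x \<in> G \<Longrightarrow> y \<in> G \<Longrightarrow> x - y \<in> G"
    and circ: "\<And>c. circuit A c \<Longrightarrow> supp c \<subseteq> S \<Longrightarrow> c \<in> G"
    and u: "u \<in> ker_lattice A" "supp u \<subseteq> S"
  shows "u \<in> G"
proof -
  have neg: "- x \<in> G" if "x \<in> G" for x using diff [OF zero that] by simp
  have add: "x + y \<in> G" if "x \<in> G" "y \<in> G" for x y using diff [OF that(1) neg [OF that(2)]] by simp
  have nmult: "int k *s x \<in> G" if "x \<in> G" for x k
    by (induction k) (use zero add that in \<open>auto simp: vector_sadd_rdistrib\<close>)
  have mult: "z *s x \<in> G" if "x \<in> G" for x z
  proof (cases "z \<ge> 0")
    case True
    then show ?thesis using nmult [OF that, of "nat z"] by simp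
  next
    case False
    moreover have "z *s x = - ((- z) *s x)" by (simp add: vec_eq_iff)
    ultimately show ?thesis using nmult [OF that, of "nat (- z)"] neg by simp
  qed
  have away_from_prime: "\<exists>n. \<not> p dvd n \<and> n *s u \<in> G"
    if "prime (p::int)" "u \<in> ker_lattice A" "supp u \<subseteq> S" for p u
    using that(2,3)
  proof (induction "card (supp u)" arbitrary: u rule: less_induct)
    case less
    show ?case
    proof (cases "u = 0")
      case True
      then show ?thesis using zero \<open>prime p\<close> by (intro exI [of _ 1]) (auto simp: not_prime_unit)
    next
      case False
      then obtain d where d: "circuit A d" "supp d \<subseteq> supp u"
        using circuit_within_support less.prems by blast
      have "\<exists>j. \<not> p dvd d $ j"
      proof (rule ccontr)
        assume "\<nexists>j. \<not> p dvd d $ j"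
        then have "p dvd Gcd (range (\<lambda>i. d $ i))" by (intro Gcd_greatest) auto
        then show False using d \<open>prime p\<close> by (auto simp: circuit_def not_prime_unit)
      qed
      then obtain j where j: "\<not> p dvd d $ j" by auto
      then have "d $ j \<noteq> 0" by auto
      define u' where "u' = d $ j *s u - u $ j *s d"
      have ker': "u' \<in> ker_lattice A"
        unfolding u'_def using less.prems d by (intro ker_lattice_lincomb) (auto simp: circuit_def)
      have "supp u' \<subseteq> supp u - {j}" using d(2) by (auto simp: u'_def supp_def)
      moreover have "j \<in> supp u" using d(2) \<open>d $ j \<noteq> 0\<close> by (auto simp: supp_def)
      ultimately have sub: "supp u' \<subset> supp u" by auto
      then have "card (supp u') < card (supp u)" by (intro psubset_card_mono) auto
      then obtain n where n: "\<not> p dvd n" "n *s u' \<in> G"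
        using less.hyps [of u'] ker' sub less.prems by auto
      have "(n * d $ j) *s u = n *s u' + (n * u $ j) *s d"
        by (simp add: u'_def vec_eq_iff algebra_simps)
      moreover have "d \<in> G" using circ d less.prems by auto
      ultimately have "(n * d $ j) *s u \<in> G" using add n(2) mult by simp
      moreover have "\<not> p dvd n * d $ j" using j n(1) \<open>prime p\<close> by (simp add: prime_dvd_mult_iff)
      ultimately show ?thesis by blast
    qed
  qed
  have "1 \<in> {n. n *s u \<in> G}"
  proof (rule int_subgroup_contains_one)
    fix x y assume "x \<in> {n. n *s u \<in> G}" "y \<in> {n. n *s u \<in> G}"
    then show "x - y \<in> {n. n *s u \<in> G}"
      using diff [of "x *s u" "y *s u"] by (simp add: vector_ssub_ldistrib vec.scale_left_diff_distrib)
  next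
    fix p :: int assume "prime p"
    then show "\<exists>n\<in>{n. n *s u \<in> G}. \<not> p dvd n" using away_from_prime [OF _ u] by auto
  qed
  then show ?thesis by simp
qed

text \<open>
  A coordinate functional of the reals as a vector space over the rationals; the lemma keeps only
  its additivity and its compatibility with integer multiples.
\<close>
lemma rational_functional:
  assumes "x \<noteq> (0::real)"
  obtains f :: "real \<Rightarrow> rat" where "f x \<noteq> 0" "\<And>a b. f (a + b) = f a + f b"
    "\<And>z a. f (real_of_int z * a) = of_int z * f a"
proof -
  interpret real_rat: vector_space_pair "\<lambda>q x. real_of_rat q * x" "(*) :: rat \<Rightarrow> rat \<Rightarrow> rat"
    by unfold_locales (auto simp: algebra_simps of_rat_add of_rat_mult)
  have "real_rat.vs1.independent {x}"
    using assms by (simp add: real_rat.vs1.dependent_single)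
  from real_rat.linear_independent_extend [OF this, of "\<lambda>_. 1"]
  obtain f where f: "Vector_Spaces.linear (\<lambda>q x. real_of_rat q * x) (*) f" "f x = 1"
    by auto
  interpret f: Vector_Spaces.linear "\<lambda>q x. real_of_rat q * x" "(*)" f by fact
  show ?thesis
    using that [of f] f(2) f.add f.scale [of "of_int _"] by simp
qed

text \<open>
  Since the matrix is integral, applying a rational functional to every coordinate of a real kernel
  vector gives a rational kernel vector with no larger support, and denominators can be cleared. The
  functional is chosen not to vanish at the coordinate that has to survive.
\<close>
lemma integral_kernel_vector:
  fixes A :: "int ^ 'n ^ 'd" and v :: "real ^ 'n"
  assumes v: "real_mat A *v v = 0" and k: "v $ k \<noteq> 0"
  obtains u :: "int ^ 'n" where "u \<in> ker_lattice A" "u $ k \<noteq> 0" "supp u \<subseteq> supp v"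
proof -
  obtain f :: "real \<Rightarrow> rat" where fk: "f (v $ k) \<noteq> 0" and f_add: "\<And>a b. f (a + b) = f a + f b"
    and f_scale: "\<And>z a. f (real_of_int z * a) = of_int z * f a"
    using rational_functional [OF k] by blast
  have f0: "f 0 = 0" using f_add [of 0 0] by simp
  have f_sum: "f (sum h S) = (\<Sum>j\<in>S. f (h j))" if "finite S" for h and S :: "'n set"
    using that by (induction S) (auto simp: f0 f_add)
  have ker: "(\<Sum>j\<in>UNIV. of_int (A $ i $ j) * f (v $ j)) = 0" for i
  proof -
    have "(\<Sum>j\<in>UNIV. real_of_int (A $ i $ j) * v $ j) = 0"
      using v by (simp add: vec_eq_iff mult_vec_component real_mat_def map_matrix_def)
    then have "f (\<Sum>j\<in>UNIV. real_of_int (A $ i $ j) * v $ j) = 0" by (simp add: f0)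
    then show ?thesis by (simp add: f_sum f_scale)
  qed
  have "\<exists>a b. b \<noteq> 0 \<and> f (v $ j) = of_int a / of_int b" for j
    by (metis Rat_cases Fract_of_int_quotient less_irrefl)
  then obtain a b where ab: "\<And>j. b j \<noteq> 0" "\<And>j. f (v $ j) = of_int (a j) / of_int (b j)"
    by metis
  define u :: "int ^ 'n" where "u = (\<chi> j. a j * (\<Prod>i\<in>UNIV - {j}. b i))"
  define c where "c = (\<Prod>i\<in>UNIV. b i)"
  have c0: "c \<noteq> 0" using ab(1) by (simp add: c_def)
  have uj: "of_int (u $ j) = of_int c * f (v $ j)" for j
  proof -
    have "c = b j * (\<Prod>i\<in>UNIV - {j}. b i)" unfolding c_def by (rule prod.remove) auto
    then show ?thesis using ab by (simp add: u_def)
  qed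
  show ?thesis
  proof (rule that)
    have "of_int (\<Sum>j\<in>UNIV. A $ i $ j * u $ j) = (0::rat)" for i
    proof -
      have "of_int (\<Sum>j\<in>UNIV. A $ i $ j * u $ j) = of_int c * (\<Sum>j\<in>UNIV. of_int (A $ i $ j) * f (v $ j))"
        by (simp add: uj sum_distrib_left algebra_simps)
      then show ?thesis by (simp add: ker)
    qed
    then show "u \<in> ker_lattice A" by (simp only: ker_lattice_iff of_int_eq_0_iff) simp
    have "of_int (u $ k) \<noteq> (0::rat)" using fk c0 by (simp add: uj)
    then show "u $ k \<noteq> 0" by auto
    have "u $ j = 0" if "v $ j = 0" for j
    proof -
      have "of_int (u $ j) = (0::rat)" by (simp add: uj that f0)
      then show ?thesis by simp
    qed
    then show "supp u \<subseteq> supp v" by (auto simp: supp_def)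
  qed
qed

lemma real_mat_of_int:
  assumes "u \<in> ker_lattice A"
  shows "real_mat A *v (\<chi> i. real_of_int (u $ i)) = 0"
proof -
  have "(\<Sum>j\<in>UNIV. real_of_int (A $ i $ j) * real_of_int (u $ j))
      = real_of_int (\<Sum>j\<in>UNIV. A $ i $ j * u $ j)" for i by simp
  then show ?thesis
    using assms by (simp add: vec_eq_iff mult_vec_component real_mat_def map_matrix_def ker_lattice_iff
        flip: of_int_mult of_int_sum)
qed

text \<open>
  Induction on the support. Take a circuit \<open>d\<close> below \<open>v\<close>, with the sign chosen so that subtracting
  it cannot shrink coordinate \<open>k\<close>. If \<open>d\<close> agrees in sign with \<open>v\<close> somewhere, subtract the largest
  multiple of \<open>d\<close> that reverses no sign of \<open>v\<close>: a coordinate vanishes and \<open>k\<close> stays. Otherwise \<open>- d\<close>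
  is the required circuit.
\<close>
lemma conformal_circuit:
  fixes A :: "int ^ 'n ^ 'd" and v :: "real ^ 'n"
  assumes "real_mat A *v v = 0" "v $ k \<noteq> 0"
  shows "\<exists>c. circuit A c \<and> c $ k \<noteq> 0 \<and> (\<forall>i. c $ i \<noteq> 0 \<longrightarrow> real_of_int (c $ i) * v $ i > 0)"
  using assms
proof (induction "card (supp v)" arbitrary: v rule: less_induct)
  case less
  obtain u where "u \<in> ker_lattice A" "u $ k \<noteq> 0" "supp u \<subseteq> supp v"
    using integral_kernel_vector less.prems by blast
  then obtain d0 where d0: "circuit A d0" "supp d0 \<subseteq> supp v"
    using circuit_within_support [of u A] by (metis order_trans zero_index)
  obtain j where j: "d0 $ j \<noteq> 0" using d0(1) by (auto simp: circuit_def vec_eq_iff)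
  have nz: "v $ i \<noteq> 0" if "d0 $ i \<noteq> 0" for i using d0(2) that by (auto simp: supp_def)
  \<comment> \<open>The second disjunct is what makes \<open>- d\<close> usable when \<open>d\<close> agrees in sign with \<open>v\<close> nowhere.\<close>
  have "\<exists>d. circuit A d \<and> supp d \<subseteq> supp v \<and> d $ k * v $ k \<le> 0 \<and>
     ((\<exists>i. d $ i * v $ i > 0) \<or> d $ k \<noteq> 0)"
  proof -
    consider "d0 $ k \<noteq> 0" "d0 $ k * v $ k \<le> 0" | "d0 $ k \<noteq> 0" "d0 $ k * v $ k > 0"
      | "d0 $ k = 0" "d0 $ j * v $ j > 0" | "d0 $ k = 0" "d0 $ j * v $ j < 0"
      using nz [OF j] j by (metis linorder_neqE_linordered_idom not_less mult_eq_0_iff of_int_eq_0_iff)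
    then show ?thesis
    proof cases
      case 1 then show ?thesis using d0 by blast
    next
      case 2 then show ?thesis using d0 by (intro exI [of _ "- d0"]) (auto simp: circuit_uminus)
    next
      case 3 then show ?thesis using d0 by (intro exI [of _ d0]) auto
    next
      case 4 then show ?thesis using d0 by (intro exI [of _ "- d0"]) (auto simp: circuit_uminus intro!: exI [of _ j])
    qed
  qed
  then obtain d where d: "circuit A d" "supp d \<subseteq> supp v" "d $ k * v $ k \<le> 0"
    and alt: "(\<exists>i. d $ i * v $ i > 0) \<or> d $ k \<noteq> 0" by blast
  have dnz: "v $ i \<noteq> 0" if "d $ i \<noteq> 0" for i using d(2) that by (auto simp: supp_def)
  show ?case
  proof (cases "\<exists>i. d $ i * v $ i > 0")
    case False
    then have neg: "real_of_int (d $ i) * v $ i < 0" if "d $ i \<noteq> 0" for i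
      using dnz [OF that] that by (metis linorder_neqE_linordered_idom mult_eq_0_iff of_int_eq_0_iff)
    show ?thesis
      using False alt neg d(1) by (intro exI [of _ "- d"]) (auto simp: circuit_uminus)
  next
    case True
    define I where "I = {i. d $ i * v $ i > 0}"
    define t where "t = Min ((\<lambda>i. v $ i / d $ i) ` I)"
    have I: "finite I" "I \<noteq> {}" using True by (auto simp: I_def)
    have "t \<in> (\<lambda>i. v $ i / d $ i) ` I" unfolding t_def using I by (intro Min_in) auto
    then obtain i0 where i0: "i0 \<in> I" "t = v $ i0 / d $ i0" by auto
    have tle: "t \<le> v $ i / d $ i" if "i \<in> I" for i unfolding t_def using I that by (intro Min_le) auto
    have tpos: "t > 0" using i0 by (auto simp: I_def zero_less_mult_iff zero_less_divide_iff)
    define v' where "v' = v - t *\<^sub>R (\<chi> i. real_of_int (d $ i))"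
    have v'i: "v' $ i = v $ i - t * d $ i" for i by (simp add: v'_def)
    have ker': "real_mat A *v v' = 0"
      using less.prems(1) real_mat_of_int [of d A] d(1)
      by (simp add: v'_def matrix_vector_mult_diff_distrib matrix_vector_mult_scaleR circuit_def)
    have prod: "v' $ i * v $ i = (v $ i)\<^sup>2 - t * (d $ i * v $ i)" for i
      by (simp add: v'i power2_eq_square algebra_simps)
    have conf: "v' $ i * v $ i > 0" if "v' $ i \<noteq> 0" for i
    proof -
      have vi: "v $ i \<noteq> 0" using that dnz [of i] v'i [of i] by auto
      have "v' $ i * v $ i \<ge> 0"
      proof (cases "i \<in> I")
        case True
        then have pos: "d $ i * v $ i > 0" by (simp add: I_def)
        have "t * (d $ i * v $ i) \<le> (v $ i / d $ i) * (d $ i * v $ i)"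
          using tle [OF True] pos by (intro mult_right_mono) auto
        also have "\<dots> = (v $ i)\<^sup>2" using pos by (auto simp: power2_eq_square)
        finally show ?thesis by (simp add: prod)
      next
        case False
        then have "t * (d $ i * v $ i) \<le> 0" 
          using tpos False
          by (intro mult_nonneg_nonpos [of t "d $ i * v $ i"]) (simp_all add: I_def not_less)
        then show ?thesis using zero_le_power2 [of "v $ i"] prod [of i] by linarith
      qed
      then show ?thesis using that vi by (simp add: order.not_eq_order_implies_strict)
    qed
    have "v' $ i0 = 0" using i0 by (auto simp: v'i I_def)
    moreover have "i0 \<in> supp v" using i0 by (auto simp: I_def supp_def)
    moreover have "supp v' \<subseteq> supp v" using conf by (force simp: supp_def)
    ultimately have "supp v' \<subset> supp v" by (auto simp: supp_def)
    then have card: "card (supp v') < card (supp v)" by (intro psubset_card_mono) auto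
    have "t * (d $ k * v $ k) \<le> 0" using tpos d(3) by (simp add: mult_nonneg_nonpos)
    moreover have "(v $ k)\<^sup>2 > 0" using less.prems(2) by simp
    ultimately have "v' $ k * v $ k > 0" using prod [of k] by linarith
    then have "v' $ k \<noteq> 0" by auto
    then obtain c where c: "circuit A c" "c $ k \<noteq> 0" "\<forall>i. c $ i \<noteq> 0 \<longrightarrow> real_of_int (c $ i) * v' $ i > 0"
      using less.hyps [OF card ker'] by auto
    have "real_of_int (c $ i) * v $ i > 0" if "c $ i \<noteq> 0" for i
    proof -
      have "real_of_int (c $ i) * v' $ i > 0" using c(3) that by blast
      moreover from this have "v' $ i * v $ i > 0" by (intro conf) auto
      ultimately show ?thesis by (auto simp: zero_less_mult_iff)
    qed
    with c show ?thesis by blast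
  qed
qed

section \<open>Faces recognized by circuits\<close>

text \<open>
  The form in which faces arise from the algebra: if a prime contains the binomial of a circuit but
  none of the variables in its positive part, it contains none of those in its negative part. Since
  the negative of a circuit is a circuit, the condition is symmetric in the two parts.
\<close>
definition circuit_closed :: "int ^ 'n ^ 'd \<Rightarrow> 'n set \<Rightarrow> bool" where
  "circuit_closed A \<sigma> \<longleftrightarrow>
     (\<forall>c. circuit A c \<longrightarrow> (\<forall>i. c $ i > 0 \<longrightarrow> i \<in> \<sigma>) \<longrightarrow> (\<forall>i. c $ i < 0 \<longrightarrow> i \<in> \<sigma>))"

text \<open>
  By conformality, the condition on circuits extends to every real linear relation among the columns.
\<close>
lemma circuit_closed_kernel:
  fixes v :: "real ^ 'n"
  assumes "circuit_closed A \<sigma>" "real_mat A *v v = 0" "\<And>i. v $ i > 0 \<Longrightarrow> i \<in> \<sigma>" "v $ k < 0"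
  shows "k \<in> \<sigma>"
proof -
  obtain c where c: "circuit A c" "c $ k \<noteq> 0"
    and conf: "\<And>i. c $ i \<noteq> 0 \<Longrightarrow> real_of_int (c $ i) * v $ i > 0"
    using conformal_circuit [of A v k] assms by fastforce
  have "c $ i > 0 \<Longrightarrow> i \<in> \<sigma>" for i
    using conf [of i] by (intro assms(3)) (auto simp: zero_less_mult_iff)
  moreover have "c $ k < 0" using conf [OF c(2)] assms(4) by (auto simp: zero_less_mult_iff)
  ultimately show ?thesis using assms(1) c(1) unfolding circuit_closed_def by blast
qed

lemma circuit_closed_lattice:
  fixes u :: "int ^ 'n"
  assumes "circuit_closed A \<sigma>" "u \<in> ker_lattice A"
  shows "supp (pos_part u) \<subseteq> \<sigma> \<longleftrightarrow> supp (neg_part u) \<subseteq> \<sigma>"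
proof -
  have half: "k \<in> \<sigma>" if "w \<in> ker_lattice A" "\<And>i. w $ i > 0 \<Longrightarrow> i \<in> \<sigma>" "w $ k < 0" for w :: "int ^ 'n" and k
    using circuit_closed_kernel [OF assms(1) real_mat_of_int [OF that(1)], of k] that by simp
  have pos: "supp (pos_part u) \<subseteq> \<sigma> \<longleftrightarrow> (\<forall>i. u $ i > 0 \<longrightarrow> i \<in> \<sigma>)"
    by (auto simp: supp_def pos_part_def)
  have neg: "supp (neg_part u) \<subseteq> \<sigma> \<longleftrightarrow> (\<forall>i. u $ i < 0 \<longrightarrow> i \<in> \<sigma>)"
    by (auto simp: supp_def neg_part_def)
  show ?thesis
    unfolding pos neg
  proof (intro iffI allI impI)
    show "i \<in> \<sigma>" if "\<forall>i. u $ i > 0 \<longrightarrow> i \<in> \<sigma>" "u $ i < 0" for i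
      using half [OF assms(2), of i] that by blast
    show "i \<in> \<sigma>" if "\<forall>i. u $ i < 0 \<longrightarrow> i \<in> \<sigma>" "u $ i > 0" for i
      using half [OF ker_lattice_uminus [OF assms(2)], of i] that by simp
  qed
qed

lemma convex_cone_hull_columns:
  fixes M :: "real ^ 'n ^ 'd"
  shows "convex_cone hull (columns M) = {M *v \<nu> | \<nu>. \<forall>i. \<nu> $ i \<ge> 0}" (is "_ = ?C")
proof (rule hull_unique)
  show "columns M \<subseteq> ?C"
  proof
    fix x assume "x \<in> columns M"
    then obtain j where "x = column j M" by (auto simp: columns_def)
    then have "x = M *v axis j 1" by (simp add: matrix_vector_mult_basis)
    then show "x \<in> ?C" by (auto simp: axis_def)
  qed
  show "convex_cone ?C"
    unfolding convex_cone_iff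
  proof (intro conjI ballI allI impI)
    show "0 \<in> ?C" by (auto intro!: exI [of _ 0])
    fix x assume "x \<in> ?C"
    then obtain \<nu> where x: "x = M *v \<nu>" "\<forall>i. \<nu> $ i \<ge> 0" by auto
    {
      fix y assume "y \<in> ?C"
      then obtain \<mu> where "y = M *v \<mu>" "\<forall>i. \<mu> $ i \<ge> 0" by auto
      then show "x + y \<in> ?C" using x
        by (auto intro!: exI [of _ "\<nu> + \<mu>"] simp: matrix_vector_right_distrib)
    }
    {
      fix c :: real assume "c \<ge> 0"
      then show "c *\<^sub>R x \<in> ?C" using x
        by (auto intro!: exI [of _ "c *\<^sub>R \<nu>"] simp: matrix_vector_mult_scaleR)
    }
  qed
  fix T assume T: "columns M \<subseteq> T" "convex_cone T"
  show "?C \<subseteq> T"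
  proof
    fix x assume "x \<in> ?C"
    then obtain \<nu> where x: "x = M *v \<nu>" "\<forall>i. \<nu> $ i \<ge> 0" by auto
    have "(\<Sum>j\<in>S. \<nu> $ j *\<^sub>R column j M) \<in> T" if "finite S" for S
      using that
    proof induction
      case empty
      then show ?case using T(2) by (simp add: convex_cone_contains_0)
    next
      case (insert j S)
      have "\<nu> $ j *\<^sub>R column j M \<in> T"
        using T x by (intro convex_cone_scaleR) (auto simp: columns_def)
      then show ?case using insert T(2) by (simp add: convex_cone_add)
    qed
    moreover have "x = (\<Sum>j\<in>UNIV. \<nu> $ j *\<^sub>R column j M)"
      by (simp add: x matrix_mult_sum scalar_mult_eq_scaleR)
    ultimately show "x \<in> T" by simp
  qed
qed

text \<open>
  The candidate face is the subcone spanned by the columns in \<open>\<sigma>\<close>. If one of its points lies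
  strictly between \<open>a\<close> and \<open>b\<close>, comparing coefficients gives a linear relation whose positive part is
  supported in \<open>\<sigma>\<close>; so is then its negative part, which carries the coefficients of \<open>a\<close> and \<open>b\<close> outside
  \<open>\<sigma>\<close>. The same argument shows that no further column lies in the subcone.
\<close>
lemma circuit_closed_imp_cone_face:
  fixes A :: "int ^ 'n ^ 'd"
  assumes "circuit_closed A \<sigma>"
  shows "cone_face A \<sigma>"
proof -
  let ?M = "real_mat A"
  define F where "F = {?M *v \<nu> | \<nu>. (\<forall>i. \<nu> $ i \<ge> 0) \<and> supp \<nu> \<subseteq> \<sigma>}"
  have cone: "cone_of A = {?M *v \<nu> | \<nu>. \<forall>i. \<nu> $ i \<ge> 0}"
    by (simp add: cone_of_def convex_cone_hull_columns)
  have convF: "convex F"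
    unfolding convex_alt
  proof (intro ballI allI impI)
    fix x y and t :: real assume "x \<in> F" "y \<in> F" and t: "0 \<le> t \<and> t \<le> 1"
    then obtain \<nu> \<mu> where "x = ?M *v \<nu>" "\<forall>i. \<nu> $ i \<ge> 0" "supp \<nu> \<subseteq> \<sigma>"
       "y = ?M *v \<mu>" "\<forall>i. \<mu> $ i \<ge> 0" "supp \<mu> \<subseteq> \<sigma>" unfolding F_def by blast
    then have "(1 - t) *\<^sub>R x + t *\<^sub>R y = ?M *v ((1 - t) *\<^sub>R \<nu> + t *\<^sub>R \<mu>)"
      "\<forall>i. ((1 - t) *\<^sub>R \<nu> + t *\<^sub>R \<mu>) $ i \<ge> 0"
      "supp ((1 - t) *\<^sub>R \<nu> + t *\<^sub>R \<mu>) \<subseteq> supp \<nu> \<union> supp \<mu>"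
      using t by (auto simp: matrix_vector_right_distrib matrix_vector_mult_scaleR supp_def)
    then show "(1 - t) *\<^sub>R x + t *\<^sub>R y \<in> F"
      using \<open>supp \<nu> \<subseteq> \<sigma>\<close> \<open>supp \<mu> \<subseteq> \<sigma>\<close> unfolding F_def by blast
  qed
  have face: "F face_of cone_of A"
    unfolding face_of_def
  proof (intro conjI ballI impI)
    show "F \<subseteq> cone_of A" by (auto simp: F_def cone)
    show "convex F" by (fact convF)
    fix a b x assume "a \<in> cone_of A" "b \<in> cone_of A" "x \<in> F" and seg: "x \<in> open_segment a b"
    then obtain l m \<nu> where l: "a = ?M *v l" "\<forall>i. l $ i \<ge> 0" and m: "b = ?M *v m" "\<forall>i. m $ i \<ge> 0"
      and n: "x = ?M *v \<nu>" "\<forall>i. \<nu> $ i \<ge> 0" "supp \<nu> \<subseteq> \<sigma>" unfolding F_def cone by blast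
    obtain t where t: "0 < t" "t < 1" "x = (1 - t) *\<^sub>R a + t *\<^sub>R b"
      using seg by (auto simp: in_segment)
    define v where "v = \<nu> - ((1 - t) *\<^sub>R l + t *\<^sub>R m)"
    have ker: "?M *v v = 0"
      using t(3) l m n
      by (simp add: v_def matrix_vector_mult_diff_distrib matrix_vector_right_distrib
          matrix_vector_mult_scaleR)
    have le: "(1 - t) * l $ i \<ge> 0" "t * m $ i \<ge> 0" for i using t l m by auto
    have "v $ i > 0 \<Longrightarrow> i \<in> \<sigma>" for i
      using n(3) le [of i] by (force simp: v_def supp_def)
    then have neg: "v $ k < 0 \<Longrightarrow> k \<in> \<sigma>" for k
      using circuit_closed_kernel [OF assms ker] by blast
    have out: "l $ k = 0 \<and> m $ k = 0" if "k \<notin> \<sigma>" for k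
    proof -
      have "\<nu> $ k = 0" using n(3) that by (auto simp: supp_def)
      moreover have "\<not> v $ k < 0" using neg [of k] that by blast
      ultimately have "(1 - t) * l $ k + t * m $ k \<le> 0" by (simp add: v_def)
      then have "(1 - t) * l $ k = 0" "t * m $ k = 0" using le [of k] by linarith+
      then show ?thesis using t by auto
    qed
    then have "supp l \<subseteq> \<sigma>" "supp m \<subseteq> \<sigma>" by (auto simp: supp_def)
    then show "a \<in> F" "b \<in> F" unfolding F_def using l m by auto
  qed
  have "\<sigma> = {j. column j ?M \<in> F}"
  proof (intro equalityI subsetI CollectI)
    fix j assume "j \<in> \<sigma>"
    then have "supp (axis j (1::real)) \<subseteq> \<sigma>" by (auto simp: supp_def axis_def)
    moreover have "\<forall>i. axis j (1::real) $ i \<ge> 0" by (auto simp: axis_def)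
    ultimately show "column j ?M \<in> F"
      unfolding F_def by (auto simp: matrix_vector_mult_basis [symmetric] simp del: matrix_vector_mult_basis)
  next
    fix j assume "j \<in> {j. column j ?M \<in> F}"
    then obtain \<nu> where n: "column j ?M = ?M *v \<nu>" "\<forall>i. \<nu> $ i \<ge> 0" "supp \<nu> \<subseteq> \<sigma>" by (auto simp: F_def)
    show "j \<in> \<sigma>"
    proof (rule ccontr)
      assume j: "j \<notin> \<sigma>"
      define v where "v = \<nu> - axis j 1"
      have ker: "?M *v v = 0" using n(1) by (simp add: v_def matrix_vector_mult_diff_distrib matrix_vector_mult_basis)
      have "v $ i > 0 \<Longrightarrow> i \<in> \<sigma>" for i
        using n(2,3) by (auto simp: v_def supp_def axis_def split: if_splits)
      moreover have "\<nu> $ j = 0" using n(3) j by (auto simp: supp_def)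
      then have "v $ j < 0" by (simp add: v_def)
      ultimately show False using circuit_closed_kernel [OF assms ker] j by blast
    qed
  qed
  moreover have "F \<noteq> {}" unfolding F_def by (auto intro!: exI [of _ 0] simp: supp_def)
  ultimately show ?thesis using face unfolding cone_face_def by blast
qed

section \<open>Ideals as submodules of the ring\<close>

interpretation ideals: Modules.module "(*) :: 'a::comm_ring_1 \<Rightarrow> 'a \<Rightarrow> 'a"
  by unfold_locales (auto simp: algebra_simps)

(* As a simplification rule this law reassociates products to the left, against mult.assoc. *)
declare ideals.scale_scale [simp del]

lemma ideal_ring_of_type_algebra_iff:
  "ideal I (ring_of_type_algebra :: 'a::comm_ring_1 ring) \<longleftrightarrow> ideals.subspace I"
proof
  assume "ideal I (ring_of_type_algebra :: 'a ring)"
  then interpret I: ideal I "ring_of_type_algebra :: 'a ring" .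
  show "ideals.subspace I"
    using additive_subgroup.zero_closed [OF I.is_additive_subgroup]
      additive_subgroup.a_closed [OF I.is_additive_subgroup] I.I_l_closed
    by (auto simp: ideals.subspace_def ring_of_type_algebra_def)
next
  assume I: "ideals.subspace I"
  have "inv\<^bsub>add_monoid (ring_of_type_algebra :: 'a ring)\<^esub> x = - x" for x
  proof -
    interpret R: ring "ring_of_type_algebra :: 'a ring" by (rule ring_from_type_algebra)
    show ?thesis
      using R.minus_equality [of "- x" x] by (simp add: ring_of_type_algebra_def a_inv_def)
  qed
  moreover have "a * x \<in> I" if "a \<in> I" for a x
    using ideals.subspace_scale [OF I that, of x] by (simp add: mult.commute)
  ultimately show "ideal I (ring_of_type_algebra :: 'a ring)"
    using I ideals.subspace_neg [OF I]
    by (intro idealI ring_from_type_algebra)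
      (auto simp: ring_of_type_algebra_def subgroup_def ideals.subspace_def)
qed

lemma genideal_eq_span:
  "Idl\<^bsub>ring_of_type_algebra\<^esub> S = ideals.span (S :: 'a::comm_ring_1 set)"
  by (auto simp: genideal_def ideals.span_def hull_def ideal_ring_of_type_algebra_iff)

lemma set_add_eq_span_Un:
  "ideals.span S <+>\<^bsub>ring_of_type_algebra\<^esub> ideals.span T = ideals.span (S \<union> T :: 'a::comm_ring_1 set)"
  by (auto simp: set_add_def' ring_of_type_algebra_def ideals.span_Un)

lemma span_mult_right: "x \<in> ideals.span S \<Longrightarrow> x * c \<in> ideals.span S"
  using ideals.span_scale [of x S c] by (simp add: mult.commute)

lemma subspace_colon:
  assumes "ideals.subspace I"
  shows "ideals.subspace {g. g * f \<in> I}"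
proof (rule ideals.subspaceI; unfold mem_Collect_eq)
  show "0 * f \<in> I" using ideals.subspace_0 [OF assms] by simp
  show "(x + y) * f \<in> I" if "x * f \<in> I" "y * f \<in> I" for x y
    unfolding distrib_right by (rule ideals.subspace_add [OF assms that])
  show "(c * x) * f \<in> I" if "x * f \<in> I" for c x
    unfolding mult.assoc by (rule ideals.subspace_scale [OF assms that])
qed

section \<open>Monomials and linear extension\<close>

lemma xpow_0 [simp]: "xpow 0 = 1"
  by (simp add: xpow_def)

lemma xpow_add: "xpow (u + v) = xpow u * xpow v"
  by (simp add: xpow_def mult_single)

lemma single_eq_xpow: "Poly_Mapping.single u a = Poly_Mapping.single 0 a * xpow u"
  by (simp add: xpow_def mult_single)

lemma supp_add_nat: "supp (u + v :: nat ^ 'n) = supp u \<union> supp v"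
  by (auto simp: supp_def)

lemma supp_zero [simp]: "supp (0 :: 'a::zero ^ 'n) = {}"
  by (simp add: supp_def)

lemma poly_mapping_eq_sum_singles:
  "f = (\<Sum>u\<in>Poly_Mapping.keys f. Poly_Mapping.single u (Poly_Mapping.lookup f u))"
proof (rule poly_mapping_eqI)
  fix w
  show "Poly_Mapping.lookup f w
      = Poly_Mapping.lookup (\<Sum>u\<in>Poly_Mapping.keys f. Poly_Mapping.single u (Poly_Mapping.lookup f u)) w"
    by (auto simp: lookup_sum lookup_single when_def in_keys_iff sum.delta)
qed

lemma poly_mapping_single_induct [case_names zero single add]:
  fixes f :: "'a \<Rightarrow>\<^sub>0 'b::comm_monoid_add"
  assumes "P 0" "\<And>u a. P (Poly_Mapping.single u a)" "\<And>f g. P f \<Longrightarrow> P g \<Longrightarrow> P (f + g)"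
  shows "P f"
proof -
  have "P (\<Sum>u\<in>S. Poly_Mapping.single u (Poly_Mapping.lookup f u))" if "finite S" for S
    using that by induction (auto intro: assms)
  then show ?thesis by (subst poly_mapping_eq_sum_singles) simp
qed

definition linear_extension :: "('a \<Rightarrow> 'k \<Rightarrow> 'b::comm_monoid_add) \<Rightarrow> ('a \<Rightarrow>\<^sub>0 'k::comm_monoid_add) \<Rightarrow> 'b" where
  "linear_extension B f = (\<Sum>u\<in>Poly_Mapping.keys f. B u (Poly_Mapping.lookup f u))"

lemma linear_extension_zero [simp]: "linear_extension B 0 = 0"
  by (simp add: linear_extension_def)

lemma linear_extension_single:
  "B u 0 = 0 \<Longrightarrow> linear_extension B (Poly_Mapping.single u a) = B u a"
  by (cases "a = 0") (simp_all add: linear_extension_def)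

lemma linear_extension_add:
  assumes "\<And>u. B u 0 = 0" "\<And>u a b. B u (a + b) = B u a + B u b"
  shows "linear_extension B (f + g) = linear_extension B f + linear_extension B g"
  unfolding linear_extension_def using assms by (rule setsum_keys_plus_distrib)

section \<open>The multigrading\<close>

definition multidegree :: "int ^ 'n ^ 'd \<Rightarrow> nat ^ 'n \<Rightarrow> int ^ 'd" where
  "multidegree A u = A *v (\<chi> i. int (u $ i))"

lemma multidegree_add: "multidegree A (u + v) = multidegree A u + multidegree A v"
  by (simp add: multidegree_def vec_eq_iff matrix_vector_mult_def algebra_simps sum.distrib)

lemma multidegree_0 [simp]: "multidegree A 0 = 0"
  by (simp add: multidegree_def vec_eq_iff matrix_vector_mult_def)

definition exp_diff :: "nat ^ 'n \<Rightarrow> nat ^ 'n \<Rightarrow> int ^ 'n" where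
  "exp_diff u v = (\<chi> i. int (u $ i) - int (v $ i))"

lemma multidegree_eq_iff: "multidegree A u = multidegree A v \<longleftrightarrow> exp_diff u v \<in> ker_lattice A"
proof -
  have "A *v (exp_diff u v) = multidegree A u - multidegree A v"
    by (simp add: multidegree_def exp_diff_def vec_eq_iff matrix_vector_mult_def algebra_simps sum_subtractf)
  then show ?thesis by (simp add: ker_lattice_def)
qed

lemma exp_diff_pos_neg: "exp_diff (pos_part u) (neg_part u) = u"
  by (auto simp: exp_diff_def pos_part_def neg_part_def vec_eq_iff max_def)

lemma common_factor_of_exp_diff:
  obtains m where "u = m + pos_part (exp_diff u v)" "v = m + neg_part (exp_diff u v)"
proof
  show "u = (\<chi> i. min (u $ i) (v $ i)) + pos_part (exp_diff u v)"
    "v = (\<chi> i. min (u $ i) (v $ i)) + neg_part (exp_diff u v)"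
    by (auto simp: vec_eq_iff pos_part_def neg_part_def exp_diff_def)
qed

lemma multidegree_pos_neg: "u \<in> ker_lattice A \<Longrightarrow> multidegree A (pos_part u) = multidegree A (neg_part u)"
  by (simp add: multidegree_eq_iff exp_diff_pos_neg)

definition graded_part :: "int ^ 'n ^ 'd \<Rightarrow> int ^ 'd \<Rightarrow> ('n::finite, 'k::field) mpol \<Rightarrow> ('n, 'k) mpol" where
  "graded_part A b = linear_extension (\<lambda>u a. if multidegree A u = b then Poly_Mapping.single u a else 0)"

lemma graded_part_zero [simp]: "graded_part A b 0 = 0"
  by (simp add: graded_part_def)

lemma graded_part_single:
  "graded_part A b (Poly_Mapping.single u a) = (if multidegree A u = b then Poly_Mapping.single u a else 0)"
  unfolding graded_part_def by (subst linear_extension_single) auto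

lemma graded_part_add: "graded_part A b (f + g) = graded_part A b f + graded_part A b g"
  unfolding graded_part_def by (rule linear_extension_add) (auto simp: single_add)

lemma graded_part_uminus: "graded_part A b (- f) = - graded_part A b f"
  using graded_part_add [of A b f "- f"] by (simp add: eq_neg_iff_add_eq_0 add.commute)

lemma graded_part_diff: "graded_part A b (f - g) = graded_part A b f - graded_part A b g"
  using graded_part_add [of A b f "- g"] by (simp add: graded_part_uminus)

lemma graded_part_single_mult:
  "graded_part A b (Poly_Mapping.single u a * f) = Poly_Mapping.single u a * graded_part A (b - multidegree A u) f"
proof (induction f rule: poly_mapping_single_induct)
  case (single v c)
  then show ?case by (auto simp: mult_single graded_part_single multidegree_add algebra_simps)
qed (auto simp: graded_part_add distrib_left)

lemma sum_graded_part: "f = (\<Sum>b\<in>multidegree A ` Poly_Mapping.keys f. graded_part A b f)"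
proof -
  have hc: "graded_part A b f = (\<Sum>u | u \<in> Poly_Mapping.keys f \<and> multidegree A u = b. Poly_Mapping.single u (Poly_Mapping.lookup f u))" for b
    unfolding graded_part_def linear_extension_def by (simp add: sum.If_cases Int_def)
  have "(\<Sum>b\<in>multidegree A ` Poly_Mapping.keys f. graded_part A b f)
     = (\<Sum>u\<in>Poly_Mapping.keys f. Poly_Mapping.single u (Poly_Mapping.lookup f u))"
    unfolding hc by (rule sum.group) auto
  then show ?thesis using poly_mapping_eq_sum_singles [of f] by simp
qed

text \<open>
  Stated through all graded parts so that it can be used as a rewrite rule; the zero polynomial is
  homogeneous of every multidegree.
\<close>
definition homogeneous :: "int ^ 'n ^ 'd \<Rightarrow> int ^ 'd \<Rightarrow> ('n::finite, 'k::field) mpol \<Rightarrow> bool" where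
  "homogeneous A b f \<longleftrightarrow> (\<forall>c. graded_part A c f = (if c = b then f else 0))"

lemma homogeneous_single: "homogeneous A (multidegree A u) (Poly_Mapping.single u a)"
  by (auto simp: homogeneous_def graded_part_single)

lemma homogeneous_graded_part: "homogeneous A b (graded_part A b f)"
  unfolding homogeneous_def
  by (induction f rule: poly_mapping_single_induct) (auto simp: graded_part_single graded_part_add)

lemma homogeneous_diff: "homogeneous A b f \<Longrightarrow> homogeneous A b g \<Longrightarrow> homogeneous A b (f - g)"
  by (auto simp: homogeneous_def graded_part_diff)

lemma graded_part_mult_homogeneous:
  assumes "homogeneous A b f"
  shows "graded_part A (c + b) (g * f) = graded_part A c g * f"
proof (induction g rule: poly_mapping_single_induct)
  case (single u a)
  have "c + b - multidegree A u = b \<longleftrightarrow> multidegree A u = c" by (auto simp: algebra_simps)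
  then show ?case using assms by (auto simp: graded_part_single_mult graded_part_single homogeneous_def)
qed (auto simp: graded_part_add distrib_right)

lemma homogeneous_mult:
  assumes "homogeneous A b f" "homogeneous A c g"
  shows "homogeneous A (c + b) (g * f)"
  unfolding homogeneous_def
proof
  fix e
  have "graded_part A e (g * f) = graded_part A (e - b) g * f"
    using graded_part_mult_homogeneous [OF assms(1), of "e - b" g] by simp
  then show "graded_part A e (g * f) = (if e = c + b then g * f else 0)"
    using assms(2) by (auto simp: homogeneous_def)
qed

lemma homogeneous_xpow: "homogeneous A (multidegree A u) (xpow u)"
  by (simp add: xpow_def homogeneous_single)

lemma graded_part_xpow_mult: "graded_part A (b + multidegree A u) (xpow u * f) = xpow u * graded_part A b f"
  by (simp add: xpow_def graded_part_single_mult)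

text \<open>
  Multiplication by a generator of multidegree \<open>e\<close> shifts graded parts by \<open>e\<close>.
\<close>
lemma span_graded_part_closed:
  assumes hom: "\<And>s. s \<in> S \<Longrightarrow> \<exists>b. homogeneous A b s" and "f \<in> ideals.span S"
  shows "graded_part A b f \<in> ideals.span S"
  using assms(2)
proof (induction f rule: ideals.span_induct_alt)
  case base
  then show ?case by (simp add: ideals.span_zero)
next
  case (step c s y)
  obtain e where "homogeneous A e s" using hom step by blast
  from graded_part_mult_homogeneous [OF this, of "b - e" c]
  have "graded_part A b (c * s) = graded_part A (b - e) c * s" by simp
  then show ?case using step
    by (simp add: graded_part_add ideals.span_add ideals.span_scale ideals.span_base)
qed

section \<open>Lattice binomials and the two ideals\<close>

definition lattice_binomial :: "int ^ 'n \<Rightarrow> ('n::finite, 'k::field) mpol" where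
  "lattice_binomial u = xpow (pos_part u) - xpow (neg_part u)"

lemma homogeneous_binomial:
  assumes "u \<in> ker_lattice A"
  shows "homogeneous A (multidegree A (pos_part u)) (lattice_binomial u)"
  unfolding lattice_binomial_def
  by (intro homogeneous_diff homogeneous_xpow) (simp add: multidegree_pos_neg [OF assms] homogeneous_xpow)

lemma lattice_binomials_homogeneous:
  assumes "s \<in> lattice_binomial ` U" "U \<subseteq> ker_lattice A"
  shows "\<exists>b. homogeneous A b s"
  using assms homogeneous_binomial by blast

lemma circuit_ideal_eq_span: "circuit_ideal A = ideals.span (lattice_binomial ` Collect (circuit A))"
  by (auto simp: circuit_ideal_def genideal_eq_span lattice_binomial_def intro!: arg_cong [where f = ideals.span])

lemma toric_ideal_eq_span: "toric_ideal A = ideals.span (lattice_binomial ` ker_lattice A)"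
  by (auto simp: toric_ideal_def genideal_eq_span lattice_binomial_def intro!: arg_cong [where f = ideals.span])

lemma circuit_ideal_subset_toric_ideal: "circuit_ideal A \<subseteq> toric_ideal A"
  unfolding circuit_ideal_eq_span toric_ideal_eq_span
  by (intro ideals.span_mono) (auto simp: circuit_def)

lemma graded_part_circuit_ideal: "f \<in> circuit_ideal A \<Longrightarrow> graded_part A b f \<in> circuit_ideal A"
  unfolding circuit_ideal_eq_span
  by (rule span_graded_part_closed [OF lattice_binomials_homogeneous]) (auto simp: circuit_def)

lemma graded_part_toric_ideal: "f \<in> toric_ideal A \<Longrightarrow> graded_part A b f \<in> toric_ideal A"
  unfolding toric_ideal_eq_span
  by (rule span_graded_part_closed [OF lattice_binomials_homogeneous]) auto

text \<open>
  Two monomials of the same multidegree differ, up to a common monomial factor, by a lattice binomial.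
\<close>
lemma xpow_diff_in_toric_ideal:
  fixes A :: "int ^ 'n ^ 'd"
  assumes "multidegree A u = multidegree A v"
  shows "xpow u - xpow v \<in> (toric_ideal A :: ('n::finite, 'k::field) mpol set)"
proof -
  obtain m where m: "u = m + pos_part (exp_diff u v)" "v = m + neg_part (exp_diff u v)"
    using common_factor_of_exp_diff .
  have "(xpow m * lattice_binomial (exp_diff u v) :: ('n, 'k) mpol)
      = xpow (m + pos_part (exp_diff u v)) - xpow (m + neg_part (exp_diff u v))"
    by (simp add: xpow_add lattice_binomial_def right_diff_distrib)
  then have "(xpow u - xpow v :: ('n, 'k) mpol) = xpow m * lattice_binomial (exp_diff u v)"
    by (simp only: m [symmetric])
  moreover have "(lattice_binomial (exp_diff u v) :: ('n, 'k) mpol) \<in> toric_ideal A"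
    using assms by (auto simp: toric_ideal_eq_span multidegree_eq_iff intro: ideals.span_base)
  ultimately show ?thesis by (simp add: toric_ideal_eq_span ideals.span_scale)
qed

section \<open>The primes attached to faces\<close>

definition face_prime :: "int ^ 'n ^ 'd \<Rightarrow> 'n set \<Rightarrow> ('n::finite, 'k::field) mpol set" where
  "face_prime A \<sigma> = ideals.span ({xpow (axis j 1) | j. j \<notin> \<sigma>} \<union> lattice_binomial ` ker_lattice A)"

lemma var_prime_plus_toric_ideal: "var_prime \<sigma> <+>\<^bsub>pring\<^esub> toric_ideal A = face_prime A \<sigma>"
  by (simp add: var_prime_def genideal_eq_span toric_ideal_eq_span set_add_eq_span_Un face_prime_def)

lemma toric_ideal_subset_face_prime: "toric_ideal A \<subseteq> face_prime A \<sigma>"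
  unfolding toric_ideal_eq_span face_prime_def by (intro ideals.span_mono) auto

lemma face_prime_UNIV: "face_prime A UNIV = toric_ideal A"
  by (simp add: toric_ideal_eq_span face_prime_def)

lemma exponent_split_variable:
  fixes u :: "nat ^ 'n"
  assumes "j \<in> supp u"
  obtains v where "u = axis j 1 + v"
proof
  show "u = axis j 1 + (\<chi> i. if i = j then u $ i - 1 else u $ i)"
    using assms by (auto simp: vec_eq_iff axis_def supp_def)
qed

lemma xpow_in_face_prime:
  assumes "\<not> supp u \<subseteq> \<sigma>"
  shows "xpow u \<in> (face_prime A \<sigma> :: ('n::finite, 'k::field) mpol set)"
proof -
  obtain j where j: "j \<in> supp u" "j \<notin> \<sigma>" using assms by auto
  then obtain v where "u = axis j 1 + v" using exponent_split_variable by blast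
  then have "(xpow u :: ('n, 'k) mpol) = xpow (axis j 1) * xpow v" by (simp add: xpow_add)
  moreover have "(xpow (axis j 1) :: ('n, 'k) mpol) \<in> face_prime A \<sigma>"
    using j by (auto simp: face_prime_def intro: ideals.span_base)
  ultimately show ?thesis by (simp add: face_prime_def span_mult_right)
qed

text \<open>
  The monoid algebra homomorphism to the group algebra of \<open>\<int>\<^sup>d\<close> that sends \<open>x\<^sub>j\<close> to the Laurent
  monomial of the \<open>j\<close>-th column for \<open>j \<in> \<sigma>\<close> and to zero otherwise. Its kernel is the ideal
  \<open>face_prime A \<sigma>\<close> when \<open>\<sigma>\<close> is a face.
\<close>
definition face_map :: "int ^ 'n ^ 'd \<Rightarrow> 'n set \<Rightarrow> ('n::finite, 'k::field) mpol \<Rightarrow> (int ^ 'd) \<Rightarrow>\<^sub>0 'k" where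
  "face_map A \<sigma> =
     linear_extension (\<lambda>u a. if supp u \<subseteq> \<sigma> then Poly_Mapping.single (multidegree A u) a else 0)"

lemma face_map_zero [simp]: "face_map A \<sigma> 0 = 0"
  by (simp add: face_map_def)

lemma face_map_single:
  "face_map A \<sigma> (Poly_Mapping.single u a) = (if supp u \<subseteq> \<sigma> then Poly_Mapping.single (multidegree A u) a else 0)"
  unfolding face_map_def by (subst linear_extension_single) auto

lemma face_map_xpow:
  "face_map A \<sigma> (xpow u) = (if supp u \<subseteq> \<sigma> then Poly_Mapping.single (multidegree A u) 1 else 0)"
  by (simp add: xpow_def face_map_single)

lemma face_map_add: "face_map A \<sigma> (f + g) = face_map A \<sigma> f + face_map A \<sigma> g"
  unfolding face_map_def by (rule linear_extension_add) (auto simp: single_add)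

lemma face_map_diff: "face_map A \<sigma> (f - g) = face_map A \<sigma> f - face_map A \<sigma> g"
  using face_map_add [of A \<sigma> "f - g" g] by (simp add: algebra_simps)

lemma face_map_mult: "face_map A \<sigma> (f * g) = face_map A \<sigma> f * face_map A \<sigma> g"
proof (induction f rule: poly_mapping_single_induct)
  case (single u a)
  show ?case
  proof (induction g rule: poly_mapping_single_induct)
    case (single v c)
    show ?case by (simp add: mult_single face_map_single supp_add_nat multidegree_add)
  qed (auto simp: face_map_add distrib_left)
qed (auto simp: face_map_add distrib_right)

text \<open>
  What a face provides for lattice binomials: modulo the variables outside \<open>\<sigma>\<close>, either both terms
  survive or neither does.
\<close>
definition balanced :: "int ^ 'n ^ 'd \<Rightarrow> 'n set \<Rightarrow> bool" where
  "balanced A \<sigma> \<longleftrightarrow> (\<forall>u\<in>ker_lattice A. supp (pos_part u) \<subseteq> \<sigma> \<longleftrightarrow> supp (neg_part u) \<subseteq> \<sigma>)"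

text \<open>
  Modulo the ideal every graded piece is at most one-dimensional: monomials that are not supported in
  \<open>\<sigma>\<close> vanish, and monomials of equal multidegree coincide.
\<close>
lemma graded_part_mod_face_prime:
  fixes g :: "('n::finite, 'k::field) mpol"
  obtains w a where "a = 0 \<or> supp w \<subseteq> \<sigma> \<and> multidegree A w = c"
    "graded_part A c g - Poly_Mapping.single w a \<in> face_prime A \<sigma>"
proof (cases "\<exists>w. supp w \<subseteq> \<sigma> \<and> multidegree A w = c")
  case True
  then obtain w where w: "supp w \<subseteq> \<sigma>" "multidegree A w = c" by blast
  have "\<exists>a. graded_part A c g - Poly_Mapping.single w a \<in> face_prime A \<sigma>"
  proof (induction g rule: poly_mapping_single_induct)
    case zero
    show ?case by (intro exI [of _ 0]) (simp add: face_prime_def ideals.span_zero)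
  next
    case (single u b)
    consider "multidegree A u \<noteq> c" | "multidegree A u = c" "supp u \<subseteq> \<sigma>" | "multidegree A u = c" "\<not> supp u \<subseteq> \<sigma>"
      by blast
    then show ?case
    proof cases
      case 1
      then show ?thesis by (intro exI [of _ 0]) (simp add: graded_part_single face_prime_def ideals.span_zero)
    next
      case 2
      then have "(xpow u - xpow w :: ('n, 'k) mpol) \<in> face_prime A \<sigma>"
        using w by (intro subsetD [OF toric_ideal_subset_face_prime] xpow_diff_in_toric_ideal) simp
      then have "Poly_Mapping.single 0 b * (xpow u - xpow w) \<in> face_prime A \<sigma>"
        unfolding face_prime_def by (rule ideals.span_scale)
      then have "graded_part A c (Poly_Mapping.single u b) - Poly_Mapping.single w b \<in> face_prime A \<sigma>"
        using 2 by (simp add: graded_part_single right_diff_distrib flip: single_eq_xpow)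
      then show ?thesis by blast
    next
      case 3
      then have "Poly_Mapping.single 0 b * xpow u \<in> face_prime A \<sigma>"
        using xpow_in_face_prime unfolding face_prime_def by (intro ideals.span_scale)
      then show ?thesis
        using 3 by (intro exI [of _ 0]) (simp add: graded_part_single flip: single_eq_xpow)
    qed
  next
    case (add g h)
    then obtain a b where "graded_part A c g - Poly_Mapping.single w a \<in> face_prime A \<sigma>"
      "graded_part A c h - Poly_Mapping.single w b \<in> face_prime A \<sigma>" by blast
    from ideals.span_add [OF this [unfolded face_prime_def]]
    have "graded_part A c (g + h) - Poly_Mapping.single w (a + b) \<in> face_prime A \<sigma>"
      by (simp add: face_prime_def graded_part_add single_add algebra_simps)
    then show ?case by blast
  qed
  then show ?thesis using that w by blast
next
  case False
  have "graded_part A c g \<in> face_prime A \<sigma>"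
  proof (induction g rule: poly_mapping_single_induct)
    case (single u b)
    show ?case
    proof (cases "multidegree A u = c")
      case True
      with False have "\<not> supp u \<subseteq> \<sigma>" by blast
      then have "Poly_Mapping.single 0 b * xpow u \<in> face_prime A \<sigma>"
        using xpow_in_face_prime unfolding face_prime_def by (intro ideals.span_scale)
      then show ?thesis using True by (simp add: graded_part_single flip: single_eq_xpow)
    qed (simp add: graded_part_single face_prime_def ideals.span_zero)
  qed (auto simp: face_prime_def graded_part_add ideals.span_zero ideals.span_add)
  then show ?thesis using that [of 0] by simp
qed

lemma lookup_face_map_graded_part:
  "Poly_Mapping.lookup (face_map A \<sigma> (graded_part A c g)) c = Poly_Mapping.lookup (face_map A \<sigma> g) c"
proof (induction g rule: poly_mapping_single_induct)
  case (single u a)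
  then show ?case by (simp add: graded_part_single face_map_single lookup_single when_def)
qed (simp_all add: graded_part_add face_map_add lookup_add)

lemma subspace_contains_if_graded_part:
  assumes "ideals.subspace I" "\<And>c. graded_part A c g \<in> I"
  shows "g \<in> I"
  by (subst sum_graded_part [of g A]) (intro ideals.subspace_sum assms)

text \<open>
  A graded part is congruent to a single term \<open>a x\<^sup>w\<close>, and \<open>a\<close> is the coefficient of the image under
  the homomorphism. So if the image vanishes, all graded parts lie in the ideal.
\<close>
lemma face_prime_eq_kernel:
  fixes A :: "int ^ 'n ^ 'd"
  assumes "balanced A \<sigma>"
  shows "(face_prime A \<sigma> :: ('n::finite, 'k::field) mpol set) = {f. face_map A \<sigma> f = 0}"
proof -
  have sub: "face_map A \<sigma> f = 0" if "f \<in> face_prime A \<sigma>" for f :: "('n, 'k) mpol"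
    using that unfolding face_prime_def
  proof (induction f rule: ideals.span_induct_alt)
    case (step c s y)
    have "face_map A \<sigma> s = 0"
      using step(1)
    proof
      assume "s \<in> {xpow (axis j 1) |j. j \<notin> \<sigma>}"
      then show ?thesis by (auto simp: face_map_xpow supp_def axis_def split: if_splits)
    next
      assume "s \<in> lattice_binomial ` ker_lattice A"
      then show ?thesis
        using assms by (auto simp: balanced_def lattice_binomial_def face_map_diff face_map_xpow multidegree_pos_neg)
    qed
    then show ?case using step by (simp add: face_map_add face_map_mult)
  qed simp
  have "f \<in> face_prime A \<sigma>" if f: "face_map A \<sigma> f = 0" for f :: "('n, 'k) mpol"
  proof (rule subspace_contains_if_graded_part)
    show "ideals.subspace (face_prime A \<sigma>)" by (simp add: face_prime_def)
    fix c
    obtain w a where wa: "a = 0 \<or> supp w \<subseteq> \<sigma> \<and> multidegree A w = c"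
      "graded_part A c f - Poly_Mapping.single w a \<in> face_prime A \<sigma>"
      using graded_part_mod_face_prime .
    have "a = 0"
    proof (rule ccontr)
      assume "a \<noteq> 0"
      with sub [OF wa(2)] wa(1) have "face_map A \<sigma> (graded_part A c f) = Poly_Mapping.single c a"
        by (simp add: face_map_diff face_map_single)
      then show False
        using \<open>a \<noteq> 0\<close> lookup_face_map_graded_part [of A \<sigma> c f] by (simp add: f)
    qed
    then show "graded_part A c f \<in> face_prime A \<sigma>" using wa(2) by simp
  qed
  with sub show ?thesis by blast
qed

text \<open>
  The group algebra of \<open>\<int>\<^sup>d\<close> is a domain. Among the sums of an exponent of \<open>f\<close> and one of \<open>g\<close>, take
  \<open>b + c\<close> of maximal Euclidean norm. If also \<open>b + c = (b + e) + (c - e)\<close> with \<open>e \<noteq> 0\<close>, then by the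
  parallelogram law one of \<open>b + c + e\<close> and \<open>b + c - e\<close> has larger norm, and both are such sums. So
  \<open>b + c\<close> arises in one way only and its coefficient is a product of two nonzero coefficients.
\<close>
lemma int_group_algebra_mult_nonzero:
  fixes f g :: "(int ^ 'd) \<Rightarrow>\<^sub>0 'k::field"
  assumes "f \<noteq> 0" "g \<noteq> 0"
  shows "f * g \<noteq> 0"
proof -
  define q :: "int ^ 'd \<Rightarrow> int" where "q x = (\<Sum>i\<in>UNIV. (x $ i)\<^sup>2)" for x
  have parallelogram: "q (x + e) + q (x - e) = 2 * q x + 2 * q e" for x e
  proof -
    have "q (x + e) + q (x - e) = (\<Sum>i\<in>UNIV. (x $ i + e $ i)\<^sup>2 + (x $ i - e $ i)\<^sup>2)"
      by (simp add: q_def sum.distrib)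
    also have "\<dots> = (\<Sum>i\<in>UNIV. 2 * (x $ i)\<^sup>2 + 2 * (e $ i)\<^sup>2)"
      by (rule sum.cong) (auto simp: power2_eq_square algebra_simps)
    also have "\<dots> = 2 * q x + 2 * q e"
      by (simp add: q_def sum.distrib sum_distrib_left)
    finally show ?thesis .
  qed
  have q_pos: "q e > 0" if e: "e \<noteq> 0" for e
  proof -
    obtain i where "e $ i \<noteq> 0" using e by (auto simp: vec_eq_iff)
    then show ?thesis unfolding q_def by (intro sum_pos2 [of _ i]) auto
  qed
  define Y where "Y = Poly_Mapping.keys f \<times> Poly_Mapping.keys g"
  have Y: "finite Y" "Y \<noteq> {}" using assms by (auto simp: Y_def)
  define Q where "Q = (\<lambda>p. q (fst p + snd p)) ` Y"
  have "Max Q \<in> Q" using Y by (simp add: Q_def)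
  then obtain p where "p \<in> Y" and Max: "Max Q = q (fst p + snd p)" by (auto simp: Q_def)
  have max: "q (fst p' + snd p') \<le> q (fst p + snd p)" if "p' \<in> Y" for p'
    unfolding Max [symmetric] using Y that by (intro Max_ge) (auto simp: Q_def)
  obtain b c where p: "p = (b, c)" by (cases p)
  have bc: "b \<in> Poly_Mapping.keys f" "c \<in> Poly_Mapping.keys g" using \<open>p \<in> Y\<close> by (auto simp: Y_def p)
  have unique: "Poly_Mapping.lookup f l * Poly_Mapping.lookup g (b + c - l) = 0" if "l \<noteq> b" for l
  proof (rule ccontr)
    assume "\<not> ?thesis"
    then have l: "l \<in> Poly_Mapping.keys f" "b + c - l \<in> Poly_Mapping.keys g" by (auto simp: in_keys_iff)
    have "q (l + c) \<le> q (b + c)" using max [of "(l, c)"] l bc by (simp add: Y_def p)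
    moreover have "q (b + (b + c - l)) \<le> q (b + c)" using max [of "(b, b + c - l)"] l bc by (simp add: Y_def p)
    moreover have "q (l + c) + q (b + (b + c - l)) = 2 * q (b + c) + 2 * q (l - b)"
      using parallelogram [of "b + c" "l - b"] by (simp add: algebra_simps)
    ultimately show False using q_pos [of "l - b"] that by simp
  qed
  have "Poly_Mapping.lookup (f * g) (b + c)
      = (\<Sum>l. Poly_Mapping.lookup f l * (\<Sum>r. Poly_Mapping.lookup g r when b + c = l + r))"
    by (rule lookup_mult)
  also have "\<dots> = (\<Sum>l. Poly_Mapping.lookup f l * Poly_Mapping.lookup g (b + c - l))"
  proof (rule Sum_any.cong)
    fix l
    have "(\<Sum>r. Poly_Mapping.lookup g r when b + c = l + r) = (\<Sum>r. Poly_Mapping.lookup g r when r = b + c - l)"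
      by (rule Sum_any.cong) (auto simp: when_def algebra_simps)
    then show "Poly_Mapping.lookup f l * (\<Sum>r. Poly_Mapping.lookup g r when b + c = l + r)
        = Poly_Mapping.lookup f l * Poly_Mapping.lookup g (b + c - l)" by simp
  qed
  also have "\<dots> = (\<Sum>l. (Poly_Mapping.lookup f b * Poly_Mapping.lookup g c) when l = b)"
    using unique by (intro Sum_any.cong) (auto simp: when_def)
  also have "\<dots> = Poly_Mapping.lookup f b * Poly_Mapping.lookup g c" by simp
  finally have "Poly_Mapping.lookup (f * g) (b + c) \<noteq> 0" using bc by (simp add: in_keys_iff)
  then show ?thesis by auto
qed

lemma face_prime_is_prime:
  assumes "balanced A \<sigma>"
  shows "primeideal (face_prime A \<sigma> :: ('n::finite, 'k::field) mpol set) pring"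
proof (rule primeidealI)
  show "ideal (face_prime A \<sigma>) (pring :: ('n, 'k) mpol ring)"
    unfolding ideal_ring_of_type_algebra_iff face_prime_def by (rule ideals.subspace_span)
  show "cring (pring :: ('n, 'k) mpol ring)" by (rule cring_from_type_algebra)
  have "face_map A \<sigma> (1 :: ('n, 'k) mpol) = 1"
    using face_map_xpow [of A \<sigma> 0] by simp
  then have "(1 :: ('n, 'k) mpol) \<notin> face_prime A \<sigma>"
    unfolding face_prime_eq_kernel [OF assms] by simp
  then show "carrier (pring :: ('n, 'k) mpol ring) \<noteq> face_prime A \<sigma>"
    by (auto simp: ring_of_type_algebra_def)
  fix f g :: "('n, 'k) mpol" assume "f \<otimes>\<^bsub>pring\<^esub> g \<in> face_prime A \<sigma>"
  then have "face_map A \<sigma> f * face_map A \<sigma> g = 0"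
    by (simp add: ring_of_type_algebra_def face_prime_eq_kernel [OF assms] face_map_mult)
  then show "f \<in> face_prime A \<sigma> \<or> g \<in> face_prime A \<sigma>"
    using int_group_algebra_mult_nonzero face_prime_eq_kernel [OF assms] by blast
qed

section \<open>Finite generation of the toric ideal\<close>

lemma incseq_subsequence:
  fixes s :: "nat \<Rightarrow> nat"
  obtains r :: "nat \<Rightarrow> nat" where "strict_mono r" "incseq (\<lambda>i. s (r i))"
proof -
  obtain r where r: "strict_mono r" "monoseq (\<lambda>n. s (r n))"
    using seq_monosub [of s] by blast
  show ?thesis
  proof (cases "incseq (\<lambda>n. s (r n))")
    case True
    then show ?thesis using that r by blast
  next
    case False
    then have dec: "\<And>m n. m \<le> n \<Longrightarrow> s (r n) \<le> s (r m)"
      using r(2) by (auto simp: monoseq_def incseq_def)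
    obtain k where k: "\<And>n. s (r k) \<le> s (r n)"
      using ex_has_least_nat [of "\<lambda>_. True" 0 "\<lambda>n. s (r n)"] by auto
    have const: "s (r (k + n)) = s (r k)" for n
      using dec [of k "k + n"] k [of "k + n"] by simp
    have "strict_mono (\<lambda>n. r (k + n))"
      using r(1) by (simp add: strict_mono_def)
    then show ?thesis using that [of "\<lambda>n. r (k + n)"] by (simp add: const incseq_def)
  qed
qed

text \<open>
  Dickson's lemma for finitely many natural-valued functions: passing to a subsequence once for each
  function makes all of them nondecreasing along a sequence of distinct elements of \<open>S\<close>.
\<close>
lemma dickson:
  fixes h :: "'c \<Rightarrow> 'a \<Rightarrow> nat"
  assumes "finite C" "infinite S"
  obtains x y where "x \<in> S" "y \<in> S" "x \<noteq> y" "\<And>c. c \<in> C \<Longrightarrow> h c x \<le> h c y"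
proof -
  obtain s :: "nat \<Rightarrow> 'a" where s: "inj s" "range s \<subseteq> S"
    using infinite_countable_subset [OF assms(2)] by blast
  have "\<exists>r :: nat \<Rightarrow> nat. strict_mono r \<and> (\<forall>c\<in>C. incseq (\<lambda>i. h c (s (r i))))"
    using assms(1)
  proof induction
    case empty
    show ?case by (intro exI [of _ id]) (simp add: strict_mono_def)
  next
    case (insert c C)
    then obtain r :: "nat \<Rightarrow> nat" where r: "strict_mono r" "\<forall>c\<in>C. incseq (\<lambda>i. h c (s (r i)))"
      by blast
    obtain t :: "nat \<Rightarrow> nat" where t: "strict_mono t" "incseq (\<lambda>i. h c (s (r (t i))))"
      using incseq_subsequence [of "\<lambda>i. h c (s (r i))"] by blast
    have "incseq (\<lambda>i. h c' (s (r (t i))))" if "c' \<in> C" for c'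
      using r(2) that strict_mono_leD [OF t(1)] by (simp add: incseq_def)
    moreover have "strict_mono (\<lambda>i. r (t i))" using r(1) t(1) by (simp add: strict_mono_def)
    ultimately show ?case using t(2) by (intro exI [of _ "\<lambda>i. r (t i)"]) auto
  qed
  then obtain r :: "nat \<Rightarrow> nat" where r: "strict_mono r" "\<forall>c\<in>C. incseq (\<lambda>i. h c (s (r i)))" by blast
  show ?thesis
  proof (rule that)
    show "s (r 0) \<in> S" "s (r 1) \<in> S" using s(2) by auto
    have "r 0 < r 1" using r(1) by (simp add: strict_mono_def)
    then show "s (r 0) \<noteq> s (r 1)" using s(1) by (auto dest: injD)
    show "h c (s (r 0)) \<le> h c (s (r 1))" if "c \<in> C" for c
      using r(2) that by (auto simp: incseq_def)
  qed
qed

definition conformal_le :: "int ^ 'n \<Rightarrow> int ^ 'n \<Rightarrow> bool" where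
  "conformal_le v u \<longleftrightarrow> pos_part v \<le> pos_part u \<and> neg_part v \<le> neg_part u"

definition graver_basis :: "int ^ 'n ^ 'd \<Rightarrow> (int ^ 'n) set" where
  "graver_basis A = {u \<in> ker_lattice A. u \<noteq> 0 \<and>
     (\<forall>v \<in> ker_lattice A. v \<noteq> 0 \<longrightarrow> conformal_le v u \<longrightarrow> v = u)}"

text \<open>
  Distinct elements of the Graver basis are incomparable, positive and negative parts being read as
  one vector of natural numbers.
\<close>
lemma finite_graver_basis:
  fixes A :: "int ^ 'n ^ 'd"
  shows "finite (graver_basis A)"
proof (rule ccontr)
  assume inf: "infinite (graver_basis A)"
  define h where "h c u = (case c of Inl i \<Rightarrow> pos_part u $ i | Inr i \<Rightarrow> neg_part u $ i)"
    for c :: "'n + 'n" and u :: "int ^ 'n"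
  obtain x y where xy: "x \<in> graver_basis A" "y \<in> graver_basis A" "x \<noteq> y"
    and le: "\<And>c. h c x \<le> h c y"
    using dickson [OF finite [of UNIV] inf, of h] by auto
  have "pos_part x $ i \<le> pos_part y $ i" "neg_part x $ i \<le> neg_part y $ i" for i
    using le [of "Inl i"] le [of "Inr i"] by (simp_all add: h_def)
  then have "conformal_le x y" by (simp add: conformal_le_def less_eq_vec_def)
  then show False using xy by (auto simp: graver_basis_def)
qed

text \<open>
  If \<open>u = v + w\<close> without cancellation, the binomials of \<open>v\<close> and \<open>w\<close>, multiplied by the monomials of
  the positive part of \<open>w\<close> and of the negative part of \<open>v\<close>, add up to the binomial of \<open>u\<close>.
\<close>
lemma lattice_binomial_in_span_graver_basis:
  fixes A :: "int ^ 'n ^ 'd"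
  assumes "u \<in> ker_lattice A"
  shows "(lattice_binomial u :: ('n::finite, 'k::field) mpol)
    \<in> ideals.span (lattice_binomial ` graver_basis A)"
  using assms
proof (induction "\<Sum>i\<in>UNIV. nat \<bar>u $ i\<bar>" arbitrary: u rule: less_induct)
  case less
  consider "u = 0" | "u \<in> graver_basis A" | "u \<noteq> 0" "u \<notin> graver_basis A" by blast
  then show ?case
  proof cases
    case 1
    then show ?thesis
      by (simp add: lattice_binomial_def pos_part_def neg_part_def ideals.span_zero)
  next
    case 2
    then show ?thesis by (intro ideals.span_base) auto
  next
    case 3
    then obtain v where v: "v \<in> ker_lattice A" "v \<noteq> 0" "conformal_le v u" "v \<noteq> u"
      using less.prems by (auto simp: graver_basis_def)
    define w where "w = u - v"
    have w: "w \<in> ker_lattice A" "w \<noteq> 0"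
      using v less.prems by (auto simp: w_def ker_lattice_diff)
    have le: "max (v $ i) 0 \<le> max (u $ i) 0" "max (- v $ i) 0 \<le> max (- u $ i) 0" for i
      using v(3)
      by (auto simp: conformal_le_def less_eq_vec_def pos_part_def neg_part_def nat_le_eq_zle max_def
          split: if_splits)
    have add: "max (u $ i) 0 = max (v $ i) 0 + max (w $ i) 0"
      "max (- u $ i) 0 = max (- v $ i) 0 + max (- w $ i) 0" for i
      using le [of i] by (simp_all add: w_def max_def split: if_splits)
    have split: "pos_part u = pos_part v + pos_part w" "neg_part u = neg_part v + neg_part w"
      by (simp_all add: vec_eq_iff pos_part_def neg_part_def add nat_add_distrib)
    have abs: "nat \<bar>u $ i\<bar> = nat \<bar>v $ i\<bar> + nat \<bar>w $ i\<bar>" for i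
    proof -
      have "\<bar>u $ i\<bar> = \<bar>v $ i\<bar> + \<bar>w $ i\<bar>"
        using add [of i] by (simp add: max_def split: if_splits)
      then show ?thesis by (simp add: nat_add_distrib)
    qed
    have pos: "(\<Sum>i\<in>UNIV. nat \<bar>z $ i\<bar>) > 0" if z: "z \<noteq> 0" for z :: "int ^ 'n"
    proof -
      obtain i where "z $ i \<noteq> 0" using z by (auto simp: vec_eq_iff)
      then show ?thesis by (intro sum_pos2 [of _ i]) auto
    qed
    have "(\<Sum>i\<in>UNIV. nat \<bar>u $ i\<bar>) = (\<Sum>i\<in>UNIV. nat \<bar>v $ i\<bar>) + (\<Sum>i\<in>UNIV. nat \<bar>w $ i\<bar>)"
      by (simp add: abs sum.distrib)
    then have IH: "(lattice_binomial v :: ('n, 'k) mpol) \<in> ideals.span (lattice_binomial ` graver_basis A)"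
      "(lattice_binomial w :: ('n, 'k) mpol) \<in> ideals.span (lattice_binomial ` graver_basis A)"
      using less.hyps v(1) w(1) pos [OF v(2)] pos [OF w(2)] by simp_all
    have "(lattice_binomial u :: ('n, 'k) mpol)
        = xpow (pos_part w) * lattice_binomial v + xpow (neg_part v) * lattice_binomial w"
      unfolding lattice_binomial_def split xpow_add by (simp add: algebra_simps)
    then show ?thesis using IH by (simp add: ideals.span_add ideals.span_scale)
  qed
qed

lemma face_prime_finitely_generated:
  fixes A :: "int ^ 'n ^ 'd"
  shows "\<exists>Y :: ('n::finite, 'k::field) mpol set. finite Y \<and> Y \<subseteq> face_prime A \<sigma> \<and> face_prime A \<sigma> \<subseteq> ideals.span Y"
proof (intro exI conjI)
  let ?Y = "(\<lambda>j. xpow (axis j 1)) ` (- \<sigma>) \<union> lattice_binomial ` graver_basis A :: ('n, 'k) mpol set"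
  show "finite ?Y" by (simp add: finite_graver_basis)
  show "?Y \<subseteq> face_prime A \<sigma>"
    unfolding face_prime_def by (auto simp: graver_basis_def intro!: ideals.span_base)
  have "(lattice_binomial u :: ('n, 'k) mpol) \<in> ideals.span ?Y" if "u \<in> ker_lattice A" for u
    using lattice_binomial_in_span_graver_basis [OF that]
      ideals.span_mono [of "lattice_binomial ` graver_basis A" ?Y] by blast
  then show "face_prime A \<sigma> \<subseteq> ideals.span ?Y"
    unfolding face_prime_def by (intro ideals.span_minimal) (auto intro: ideals.span_base)
qed

section \<open>Saturation by the variables of an index set\<close>

definition saturation :: "'n set \<Rightarrow> ('n::finite, 'k::field) mpol set \<Rightarrow> ('n, 'k) mpol set" where
  "saturation \<beta> I = {f. \<exists>m. supp m \<subseteq> \<beta> \<and> xpow m * f \<in> I}"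

lemma subset_saturation: "I \<subseteq> saturation \<beta> I"
  unfolding saturation_def by (auto intro!: exI [of _ 0])

lemma subspace_saturation:
  assumes I: "ideals.subspace I"
  shows "ideals.subspace (saturation \<beta> I)"
proof (rule ideals.subspaceI)
  show "0 \<in> saturation \<beta> I" using subset_saturation ideals.subspace_0 [OF I] by blast
next
  fix f g assume "f \<in> saturation \<beta> I" "g \<in> saturation \<beta> I"
  then obtain m n where m: "supp m \<subseteq> \<beta>" "xpow m * f \<in> I" and n: "supp n \<subseteq> \<beta>" "xpow n * g \<in> I"
    unfolding saturation_def by blast
  have "xpow (m + n) * (f + g) = xpow n * (xpow m * f) + xpow m * (xpow n * g)"
    by (simp add: xpow_add algebra_simps)
  also have "\<dots> \<in> I"
    by (rule ideals.subspace_add [OF I ideals.subspace_scale [OF I m(2)] ideals.subspace_scale [OF I n(2)]])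
  finally show "f + g \<in> saturation \<beta> I"
    unfolding saturation_def using m(1) n(1) by (auto simp: supp_add_nat intro!: exI [of _ "m + n"])
next
  fix c f assume "f \<in> saturation \<beta> I"
  then obtain m where m: "supp m \<subseteq> \<beta>" "xpow m * f \<in> I"
    unfolding saturation_def by blast
  have "xpow m * (c * f) = c * (xpow m * f)" by (simp add: algebra_simps)
  also have "\<dots> \<in> I" using m(2) by (rule ideals.subspace_scale [OF I])
  finally show "c * f \<in> saturation \<beta> I" unfolding saturation_def using m(1) by blast
qed

lemma saturation_cancel:
  assumes "supp m \<subseteq> \<beta>" "xpow m * f \<in> saturation \<beta> I"
  shows "f \<in> saturation \<beta> I"
proof -
  obtain n where "supp n \<subseteq> \<beta>" "xpow (n + m) * f \<in> I"
    using assms(2) by (auto simp: saturation_def xpow_add mult.assoc)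
  then show ?thesis
    using assms(1) by (auto simp: saturation_def supp_add_nat intro!: exI [of _ "n + m"])
qed

text \<open>
  For finitely many generators the product of the individual monomials serves all of them.
\<close>
lemma uniform_saturation_exponent:
  assumes I: "ideals.subspace I" and "finite Y" "Y \<subseteq> saturation \<beta> I"
  shows "\<exists>m. supp m \<subseteq> \<beta> \<and> (\<forall>f\<in>ideals.span Y. xpow m * f \<in> I)"
proof -
  have "\<exists>m. supp m \<subseteq> \<beta> \<and> (\<forall>y\<in>Y. xpow m * y \<in> I)"
    using assms(2,3)
  proof (induction Y)
    case empty
    show ?case by (intro exI [of _ 0]) simp
  next
    case (insert y Y)
    then obtain m n where m: "supp m \<subseteq> \<beta>" "\<forall>y\<in>Y. xpow m * y \<in> I"
      and n: "supp n \<subseteq> \<beta>" "xpow n * y \<in> I" by (auto simp: saturation_def)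
    have "xpow (m + n) * z \<in> I" if "z \<in> insert y Y" for z
    proof (cases "z = y")
      case True
      then show ?thesis using ideals.subspace_scale [OF I n(2), of "xpow m"] by (simp add: xpow_add mult.assoc)
    next
      case False
      then have "xpow m * z \<in> I" using m(2) that by blast
      from ideals.subspace_scale [OF I this, of "xpow n"] show ?thesis
        by (simp add: xpow_add algebra_simps)
    qed
    then show ?case using m(1) n(1) by (intro exI [of _ "m + n"]) (auto simp: supp_add_nat)
  qed
  then obtain m where m: "supp m \<subseteq> \<beta>" "\<forall>y\<in>Y. xpow m * y \<in> I" by blast
  have "ideals.span Y \<subseteq> {f. f * xpow m \<in> I}"
    using m(2) by (intro ideals.span_minimal subspace_colon [OF I]) (auto simp: mult.commute)
  then show ?thesis using m(1) by (auto simp: mult.commute)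
qed

text \<open>
  Up to a monomial factor in the variables of \<open>S\<close>, the circuit ideal contains every lattice binomial
  in these variables. The exponent differences \<open>a - b\<close> with \<open>x\<^sup>a - x\<^sup>b\<close> in the ideal and \<open>a\<close>, \<open>b\<close>
  supported in \<open>S\<close> form a subgroup, because congruences of monomials can be multiplied; it contains
  the circuits, hence the whole lattice.
\<close>
lemma lattice_binomial_in_saturation:
  fixes u :: "int ^ 'n::finite"
  assumes "u \<in> ker_lattice A" "supp u \<subseteq> S"
  shows "lattice_binomial u \<in> saturation S (circuit_ideal A :: ('n, 'k::field) mpol set)"
proof -
  define I :: "('n, 'k) mpol set" where "I = circuit_ideal A"
  have I: "ideals.subspace I" by (simp add: I_def circuit_ideal_eq_span)
  define G where "G = {u. \<exists>a b. supp a \<subseteq> S \<and> supp b \<subseteq> S \<and> exp_diff a b = u \<and> xpow a - xpow b \<in> I}"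
  have "u \<in> G"
  proof (rule circuits_generate_ker_lattice [OF _ _ _ assms])
    show "0 \<in> G" unfolding G_def
      by (intro CollectI exI [of _ 0]) (auto simp: exp_diff_def vec_eq_iff ideals.subspace_0 [OF I])
  next
    fix u v assume "u \<in> G" "v \<in> G"
    then obtain a b a' b' where ab: "supp a \<subseteq> S" "supp b \<subseteq> S" "exp_diff a b = u" "xpow a - xpow b \<in> I"
      and ab': "supp a' \<subseteq> S" "supp b' \<subseteq> S" "exp_diff a' b' = v" "xpow a' - xpow b' \<in> I"
      unfolding G_def by blast
    have "xpow (a + b') - xpow (b + a') = xpow b' * (xpow a - xpow b) - xpow b * (xpow a' - xpow b')"
      by (simp add: xpow_add algebra_simps)
    also have "\<dots> \<in> I" 
      by (rule ideals.subspace_diff [OF I ideals.subspace_scale [OF I ab(4)] ideals.subspace_scale [OF I ab'(4)]])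
    finally have "xpow (a + b') - xpow (b + a') \<in> I" .
    moreover have "exp_diff (a + b') (b + a') = u - v"
      unfolding ab(3) [symmetric] ab'(3) [symmetric] by (simp add: exp_diff_def vec_eq_iff)
    moreover have "supp (a + b') \<subseteq> S" "supp (b + a') \<subseteq> S" using ab ab' by (auto simp: supp_add_nat)
    ultimately show "u - v \<in> G" unfolding G_def by blast
  next
    fix c assume c: "circuit A c" "supp c \<subseteq> S"
    then have "lattice_binomial c \<in> I"
      by (auto simp: I_def circuit_ideal_eq_span intro: ideals.span_base)
    moreover have "supp (pos_part c) \<subseteq> S" "supp (neg_part c) \<subseteq> S"
      using c(2) by (auto simp: supp_def pos_part_def neg_part_def)
    ultimately show "c \<in> G"
      unfolding G_def lattice_binomial_def using exp_diff_pos_neg by blast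
  qed
  then obtain a b where ab: "supp a \<subseteq> S" "exp_diff a b = u" "xpow a - xpow b \<in> I"
    unfolding G_def by blast
  obtain m where m: "a = m + pos_part u" "b = m + neg_part u"
    by (rule common_factor_of_exp_diff [of a b, unfolded ab(2)])
  have "xpow m * lattice_binomial u \<in> I"
    using ab(3) unfolding m xpow_add lattice_binomial_def by (simp add: right_diff_distrib)
  moreover have "supp m \<subseteq> S" using ab(1) by (auto simp: m(1) supp_add_nat)
  ultimately show ?thesis unfolding saturation_def I_def by blast
qed

section \<open>Initial ideals and standard pairs\<close>

lemma lookup_xpow_mult: "Poly_Mapping.lookup (xpow m * f) (m + u) = Poly_Mapping.lookup f u"
proof (induction f rule: poly_mapping_single_induct)
  case (single v a)
  show ?case by (simp add: xpow_def mult_single lookup_single)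
qed (simp_all add: distrib_left lookup_add)

lemma keys_xpow_mult: "Poly_Mapping.keys (xpow m * f) = (+) m ` Poly_Mapping.keys f"
proof
  show "Poly_Mapping.keys (xpow m * f) \<subseteq> (+) m ` Poly_Mapping.keys f"
    using keys_mult [of "xpow m" f] by (auto simp: xpow_def)
  show "(+) m ` Poly_Mapping.keys f \<subseteq> Poly_Mapping.keys (xpow m * f)"
    by (auto simp: in_keys_iff lookup_xpow_mult)
qed

lemma weight_add: "weight \<omega> (u + v) = weight \<omega> u + weight \<omega> v"
  by (simp add: weight_def distrib_left sum.distrib)

lemma initial_form_xpow_mult: "initial_form \<omega> (xpow m * f) = xpow m * initial_form \<omega> f"
proof -
  define K where "K = {u \<in> Poly_Mapping.keys f. \<forall>v\<in>Poly_Mapping.keys f. weight \<omega> v \<le> weight \<omega> u}"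
  have K: "{u. u \<in> Poly_Mapping.keys (xpow m * f) \<and>
      (\<forall>v\<in>Poly_Mapping.keys (xpow m * f). weight \<omega> v \<le> weight \<omega> u)} = (+) m ` K"
    by (auto simp: keys_xpow_mult K_def weight_add)
  have "initial_form \<omega> (xpow m * f)
      = (\<Sum>u\<in>K. Poly_Mapping.single (m + u) (Poly_Mapping.lookup (xpow m * f) (m + u)))"
    unfolding initial_form_def K by (subst sum.reindex) (auto simp: inj_on_def)
  also have "\<dots> = (\<Sum>u\<in>K. xpow m * Poly_Mapping.single u (Poly_Mapping.lookup f u))"
    unfolding lookup_xpow_mult by (simp add: xpow_def mult_single)
  also have "\<dots> = xpow m * initial_form \<omega> f"
    by (simp add: initial_form_def K_def sum_distrib_left)
  finally show ?thesis .
qed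

lemma initial_ideal_mono: "I \<subseteq> J \<Longrightarrow> initial_ideal \<omega> I \<subseteq> initial_ideal \<omega> J"
  unfolding initial_ideal_def genideal_eq_span by (intro ideals.span_mono image_mono)

text \<open>
  Taking initial forms commutes with multiplication by monomials.
\<close>
lemma initial_ideal_saturation:
  assumes "J \<subseteq> saturation \<beta> I"
  shows "initial_ideal \<omega> J \<subseteq> saturation \<beta> (initial_ideal \<omega> I)"
  unfolding initial_ideal_def genideal_eq_span
proof (intro ideals.span_minimal subspace_saturation ideals.subspace_span subsetI)
  fix h assume "h \<in> initial_form \<omega> ` J"
  then obtain f where f: "f \<in> J" "h = initial_form \<omega> f" by blast
  then obtain m where m: "supp m \<subseteq> \<beta>" "xpow m * f \<in> I"
    using assms by (auto simp: saturation_def)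
  have "xpow m * h \<in> initial_form \<omega> ` I"
    using m(2) by (auto simp: f(2) initial_form_xpow_mult [symmetric])
  then show "h \<in> saturation \<beta> (ideals.span (initial_form \<omega> ` I))"
    using m(1) by (auto simp: saturation_def intro: ideals.span_base)
qed

text \<open>
  The monomials tested by a pair with \<open>\<beta> \<subseteq> \<tau>\<close> are stable under the variables of \<open>\<beta>\<close>, so
  membership up to such a monomial factor is enough to spoil admissibility.
\<close>
lemma admissible_pair_saturation:
  assumes "M \<subseteq> N" "N \<subseteq> saturation \<beta> M" "\<beta> \<subseteq> \<tau>"
  shows "admissible_pair N v \<tau> \<longleftrightarrow> admissible_pair M v \<tau>"
proof
  assume "admissible_pair N v \<tau>"
  then show "admissible_pair M v \<tau>"
    using assms(1) unfolding admissible_pair_def standard_monomial_def by blast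
next
  assume M: "admissible_pair M v \<tau>"
  have "xpow (v + w) \<notin> N" if w: "supp w \<subseteq> \<tau>" for w
  proof
    assume "xpow (v + w) \<in> N"
    then obtain m where m: "supp m \<subseteq> \<beta>" "xpow m * xpow (v + w) \<in> M"
      using assms(2) unfolding saturation_def by blast
    then have "xpow (v + (w + m)) \<in> M" by (simp add: xpow_add algebra_simps)
    moreover have "supp (w + m) \<subseteq> \<tau>" using w m(1) assms(3) by (auto simp: supp_add_nat)
    ultimately show False using M unfolding admissible_pair_def standard_monomial_def by blast
  qed
  from this this [of 0] show "admissible_pair N v \<tau>"
    using M unfolding admissible_pair_def standard_monomial_def by simp
qed

text \<open>
  A pair that could supersede one of type \<open>\<beta>\<close> has a type containing \<open>\<beta>\<close>, so the comparison of
  admissible pairs applies to it as well.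
\<close>
lemma standard_pair_saturation:
  assumes "M \<subseteq> N" "N \<subseteq> saturation \<beta> M"
  shows "standard_pair N u \<beta> \<longleftrightarrow> standard_pair M u \<beta>"
proof -
  have "admissible_pair N v \<tau> \<longleftrightarrow> admissible_pair M v \<tau>" if "supp (u - v) \<union> \<beta> \<subseteq> \<tau>" for v \<tau>
    using admissible_pair_saturation [OF assms, of \<tau> v] that by blast
  moreover have "admissible_pair N u \<beta> \<longleftrightarrow> admissible_pair M u \<beta>"
    using admissible_pair_saturation [OF assms order_refl] .
  ultimately show ?thesis unfolding standard_pair_def by blast
qed

text \<open>
  If the toric ideal were contained in the saturation of the circuit ideal, so would be the initial
  ideals, and both would have the same standard pairs of type \<open>\<beta>\<close>.
\<close>
lemma toric_ideal_not_in_saturation_if_csp: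
  assumes "csp TYPE('k::field) A \<omega> u \<beta>"
  shows "\<not> toric_ideal A \<subseteq> saturation \<beta> (circuit_ideal A :: ('n::finite, 'k) mpol set)"
proof
  assume "toric_ideal A \<subseteq> saturation \<beta> (circuit_ideal A :: ('n, 'k) mpol set)"
  from standard_pair_saturation [OF initial_ideal_mono [OF circuit_ideal_subset_toric_ideal]
      initial_ideal_saturation [OF this]]
  show False using assms unfolding csp_def by blast
qed

section \<open>An annihilator that is a face prime\<close>

lemma exponent_induct [case_names zero add]:
  fixes w :: "nat ^ 'n"
  assumes "P 0" "\<And>j v. P v \<Longrightarrow> P (axis j 1 + v)"
  shows "P w"
proof (induction "\<Sum>i\<in>UNIV. w $ i" arbitrary: w rule: less_induct)
  case less
  show ?case
  proof (cases "w = 0")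
    case True
    then show ?thesis using assms(1) by simp
  next
    case False
    then obtain j where "j \<in> supp w" by (auto simp: supp_def vec_eq_iff)
    then obtain v where v: "w = axis j 1 + v" by (rule exponent_split_variable)
    have "(\<Sum>i\<in>UNIV. w $ i) = (\<Sum>i\<in>UNIV. axis j (1::nat) $ i) + (\<Sum>i\<in>UNIV. v $ i)"
      by (simp add: v sum.distrib)
    also have "(\<Sum>i\<in>UNIV. axis j (1::nat) $ i) = 1" by (simp add: axis_def)
    finally show ?thesis using less assms(2) v by simp
  qed
qed

lemma supp_axis_one [simp]: "supp (axis j (Suc 0)) = {j}"
  by (auto simp: supp_def axis_def)

lemma ex_homogeneous_not_in_saturation:
  fixes A :: "int ^ 'n ^ 'd"
  assumes "\<not> toric_ideal A \<subseteq> saturation \<beta> (circuit_ideal A :: ('n::finite, 'k::field) mpol set)"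
  shows "\<exists>f b. homogeneous A b f \<and> f \<in> (toric_ideal A :: ('n, 'k) mpol set)
    \<and> f \<notin> saturation \<beta> (circuit_ideal A)"
proof (rule ccontr)
  assume neg: "\<nexists>f b. homogeneous A b f \<and> f \<in> (toric_ideal A :: ('n, 'k) mpol set)
    \<and> f \<notin> saturation \<beta> (circuit_ideal A)"
  have "f \<in> saturation \<beta> (circuit_ideal A)" if "f \<in> toric_ideal A" for f :: "('n, 'k) mpol"
  proof (rule subspace_contains_if_graded_part)
    show "ideals.subspace (saturation \<beta> (circuit_ideal A :: ('n, 'k) mpol set))"
      by (rule subspace_saturation) (simp add: circuit_ideal_eq_span)
    show "graded_part A c f \<in> saturation \<beta> (circuit_ideal A)" for c
      using neg homogeneous_graded_part graded_part_toric_ideal [OF that] by blast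
  qed
  with assms show False by blast
qed

lemma graded_part_saturation:
  assumes "f \<in> saturation \<beta> (circuit_ideal A)"
  shows "graded_part A b f \<in> saturation \<beta> (circuit_ideal A)"
proof -
  obtain m where m: "supp m \<subseteq> \<beta>" "xpow m * f \<in> circuit_ideal A"
    using assms unfolding saturation_def by blast
  from graded_part_circuit_ideal [OF m(2), of "b + multidegree A m"] m(1) show ?thesis
    by (auto simp: graded_part_xpow_mult saturation_def)
qed

lemma toric_ideal_subset_saturation_UNIV:
  "toric_ideal A \<subseteq> saturation UNIV (circuit_ideal A :: ('n::finite, 'k::field) mpol set)"
proof -
  have "ideals.subspace (saturation UNIV (circuit_ideal A :: ('n, 'k) mpol set))"
    by (rule subspace_saturation) (simp add: circuit_ideal_eq_span)
  then show ?thesis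
    unfolding toric_ideal_eq_span
    by (intro ideals.span_minimal) (auto intro!: lattice_binomial_in_saturation)
qed

lemma circuit_closed_imp_balanced: "circuit_closed A \<sigma> \<Longrightarrow> balanced A \<sigma>"
  using circuit_closed_lattice unfolding balanced_def by blast

text \<open>
  Among the homogeneous elements of the toric ideal outside the saturation \<open>J\<close> choose \<open>f\<close> such that as
  many variables as possible multiply it into \<open>J\<close>, and let \<open>\<sigma>\<close> be the set of the others. Maximality
  makes the variables in \<open>\<sigma>\<close> nonzerodivisors on the homogeneous multiples of \<open>f\<close> modulo \<open>J\<close>, so that
  they may be cancelled. Three consequences follow. No circuit has its positive part but not its negative
  part inside \<open>\<sigma>\<close>. All lattice binomials inside \<open>\<sigma>\<close> kill \<open>f\<close> modulo \<open>J\<close>, because the circuit ideal contains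
  them up to a monomial in \<open>\<sigma>\<close>. And \<open>\<sigma>\<close> is not the whole index set, because some monomial multiplies
  \<open>f\<close> into the circuit ideal. The annihilator is graded and contains no monomial in \<open>\<sigma>\<close>, while
  modulo the face prime each graded part is a multiple of such a monomial; so it is no larger than the
  face prime.
\<close>
lemma ex_saturated_colon_eq_face_prime:
  fixes A :: "int ^ 'n ^ 'd"
  assumes "\<not> toric_ideal A \<subseteq> saturation \<beta> (circuit_ideal A :: ('n::finite, 'k::field) mpol set)"
  shows "\<exists>\<sigma> f. circuit_closed A \<sigma> \<and> \<beta> \<subseteq> \<sigma> \<and> \<sigma> \<noteq> UNIV \<and>
    face_prime A \<sigma> = {g :: ('n, 'k) mpol. g * f \<in> saturation \<beta> (circuit_ideal A)}"
proof -
  define I :: "('n, 'k) mpol set" where "I = circuit_ideal A"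
  define J where "J = saturation \<beta> I"
  have J: "ideals.subspace J"
    unfolding J_def I_def by (rule subspace_saturation) (simp add: circuit_ideal_eq_span)
  define killed where "killed f = {j. xpow (axis j 1) * f \<in> J}" for f
  define P where "P f \<longleftrightarrow> f \<in> toric_ideal A \<and> f \<notin> J \<and> (\<exists>b. homogeneous A b f)" for f
  have "\<exists>f. P f"
    using ex_homogeneous_not_in_saturation [OF assms] unfolding P_def J_def I_def by blast
  moreover have "card (killed f) < Suc CARD('n)" for f
    by (simp add: card_mono less_Suc_eq_le)
  ultimately obtain f where Pf: "P f" and max: "\<And>g. P g \<Longrightarrow> card (killed g) \<le> card (killed f)"
    using ex_has_greatest_nat [of P _ "\<lambda>f. card (killed f)" "Suc CARD('n)"] by blast
  obtain b where f: "f \<in> toric_ideal A" "f \<notin> J" "homogeneous A b f"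
    using Pf unfolding P_def by blast
  define \<sigma> where "\<sigma> = - killed f"
  \<comment> \<open>A multiple of \<open>f\<close> outside \<open>J\<close> competes with \<open>f\<close> for the maximum and is killed by at least
    the same variables.\<close>
  have killed_multiple: "killed (g * f) = killed f" if "homogeneous A c g" "g * f \<notin> J" for c g
  proof -
    have "g * f \<in> toric_ideal A" using f(1) by (simp add: toric_ideal_eq_span ideals.span_scale)
    then have "P (g * f)" using that homogeneous_mult [OF f(3) that(1)] by (auto simp: P_def)
    moreover have "killed f \<subseteq> killed (g * f)"
      using ideals.subspace_scale [OF J, of _ g] by (auto simp: killed_def mult.left_commute)
    ultimately show ?thesis using max by (metis card_seteq finite)
  qed
  have nonzerodivisor: "g * f \<in> J"
    if "supp w \<subseteq> \<sigma>" "homogeneous A c g" "xpow w * (g * f) \<in> J" for w c g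
    using that
  proof (induction w rule: exponent_induct)
    case zero
    then show ?case by simp
  next
    case (add j v)
    have j: "j \<in> \<sigma>" "supp v \<subseteq> \<sigma>" using add.prems(1) by (auto simp: supp_add_nat)
    have hom: "homogeneous A (multidegree A v + c) (xpow v * g)"
      using homogeneous_mult [OF add.prems(2) homogeneous_xpow] .
    have "(xpow v * g) * f \<in> J"
    proof (rule ccontr)
      assume "(xpow v * g) * f \<notin> J"
      then have "killed ((xpow v * g) * f) = killed f" by (rule killed_multiple [OF hom])
      moreover have "j \<in> killed ((xpow v * g) * f)"
        using add.prems(3) by (simp add: killed_def xpow_add mult.assoc)
      ultimately show False using j(1) by (simp add: \<sigma>_def)
    qed
    then show ?case using add.IH j(2) add.prems(2) by (simp add: mult.assoc)
  qed
  have hom1: "homogeneous A 0 (1 :: ('n, 'k) mpol)"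
    using homogeneous_xpow [of A "0 :: nat ^ 'n"] by simp
  have monomial_notin: "xpow w * f \<notin> J" if "supp w \<subseteq> \<sigma>" for w
    using nonzerodivisor [OF that hom1] f(2) by auto
  have monomial_in: "xpow w * f \<in> J" if w: "\<not> supp w \<subseteq> \<sigma>" for w
  proof -
    obtain j where j: "j \<in> supp w" "j \<in> killed f" using w by (auto simp: \<sigma>_def)
    obtain v where v: "w = axis j 1 + v" using exponent_split_variable [OF j(1)] .
    have "xpow v * (xpow (axis j 1) * f) \<in> J"
      using j(2) by (intro ideals.subspace_scale [OF J, of "xpow (axis j 1) * f"]) (simp add: killed_def)
    then show ?thesis by (simp add: v xpow_add mult_ac)
  qed
  have "\<beta> \<subseteq> \<sigma>"
  proof
    fix j assume j: "j \<in> \<beta>"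
    show "j \<in> \<sigma>"
    proof (rule ccontr)
      assume "j \<notin> \<sigma>"
      then have "xpow (axis j 1) * f \<in> J" by (intro monomial_in) simp
      then show False using saturation_cancel [of "axis j 1" \<beta> f I] j f(2) by (simp add: J_def)
    qed
  qed
  have binomial_supported: "lattice_binomial u * f \<in> J" if u: "u \<in> ker_lattice A" "supp u \<subseteq> \<sigma>" for u
  proof -
    obtain m where m: "supp m \<subseteq> \<sigma>" "xpow m * lattice_binomial u \<in> I"
      using lattice_binomial_in_saturation [OF u] unfolding saturation_def I_def by blast
    then have "xpow m * lattice_binomial u \<in> J" using subset_saturation unfolding J_def by blast
    then have "f * (xpow m * lattice_binomial u) \<in> J" by (rule ideals.subspace_scale [OF J])
    then have "xpow m * (lattice_binomial u * f) \<in> J" by (simp add: mult_ac)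
    then show ?thesis using nonzerodivisor [OF m(1) homogeneous_binomial [OF u(1)]] by blast
  qed
  have closed: "circuit_closed A \<sigma>"
    unfolding circuit_closed_def
  proof (intro allI impI)
    fix c k assume c: "circuit A c" "\<forall>i. c $ i > 0 \<longrightarrow> i \<in> \<sigma>" "c $ k < 0"
    show "k \<in> \<sigma>"
    proof (rule ccontr)
      assume k: "k \<notin> \<sigma>"
      have "k \<in> supp (neg_part c)" using c(3) by (simp add: supp_def neg_part_def)
      with k have "\<not> supp (neg_part c) \<subseteq> \<sigma>" by blast
      then have "xpow (neg_part c) * f \<in> J" by (rule monomial_in)
      moreover have "lattice_binomial c * f \<in> J"
      proof -
        have "lattice_binomial c \<in> I" using c(1) by (auto simp: I_def circuit_ideal_eq_span intro: ideals.span_base)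
        then have "lattice_binomial c \<in> J" using subset_saturation unfolding J_def by blast
        from ideals.subspace_scale [OF J this, of f] show ?thesis by (simp add: mult.commute)
      qed
      ultimately have "lattice_binomial c * f + xpow (neg_part c) * f \<in> J"
        by (intro ideals.subspace_add [OF J])
      then have "xpow (pos_part c) * f \<in> J" by (simp add: lattice_binomial_def algebra_simps)
      moreover have "supp (pos_part c) \<subseteq> \<sigma>" using c(2) by (auto simp: supp_def pos_part_def)
      ultimately show False using monomial_notin by blast
    qed
  qed
  then have balanced: "balanced A \<sigma>" by (rule circuit_closed_imp_balanced)
  have "\<sigma> \<noteq> UNIV"
  proof
    assume UNIV: "\<sigma> = UNIV"
    obtain m where "xpow m * f \<in> I"
      using f(1) toric_ideal_subset_saturation_UNIV [of A] unfolding saturation_def I_def by blast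
    then have "xpow m * f \<in> J" using subset_saturation unfolding J_def by blast
    then show False using monomial_notin [of m] UNIV by simp
  qed
  have sub: "face_prime A \<sigma> \<subseteq> {g. g * f \<in> J}"
    unfolding face_prime_def
  proof (intro ideals.span_minimal subspace_colon [OF J] Un_least)
    show "{xpow (axis j 1) |j. j \<notin> \<sigma>} \<subseteq> {g. g * f \<in> J}" by (auto intro: monomial_in)
    show "lattice_binomial ` ker_lattice A \<subseteq> {g. g * f \<in> J}"
    proof (clarify)
      fix u :: "int ^ 'n" assume u: "u \<in> ker_lattice A"
      show "lattice_binomial u * f \<in> J"
      proof (cases "supp (pos_part u) \<subseteq> \<sigma>")
        case True
        then have "supp (pos_part u) \<subseteq> \<sigma>" "supp (neg_part u) \<subseteq> \<sigma>"
          using balanced u by (auto simp: balanced_def)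
        then have "supp u \<subseteq> \<sigma>" by (force simp: supp_def pos_part_def neg_part_def)
        then show ?thesis using binomial_supported u by blast
      next
        case False
        then have "\<not> supp (neg_part u) \<subseteq> \<sigma>" using balanced u by (auto simp: balanced_def)
        with False show ?thesis
          unfolding lattice_binomial_def left_diff_distrib
          by (intro ideals.subspace_diff [OF J] monomial_in)
      qed
    qed
  qed
  have "g \<in> face_prime A \<sigma>" if g: "g * f \<in> J" for g
  proof (rule subspace_contains_if_graded_part)
    show "ideals.subspace (face_prime A \<sigma> :: ('n, 'k) mpol set)" by (simp add: face_prime_def)
    fix c
    obtain w a where wa: "a = 0 \<or> supp w \<subseteq> \<sigma> \<and> multidegree A w = c"
      "graded_part A c g - Poly_Mapping.single w a \<in> face_prime A \<sigma>"
      using graded_part_mod_face_prime .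
    have "a = 0"
    proof (rule ccontr)
      assume a: "a \<noteq> 0"
      have "graded_part A (c + b) (g * f) \<in> J"
        using g unfolding J_def I_def by (rule graded_part_saturation)
      then have "graded_part A c g * f \<in> J" by (simp add: graded_part_mult_homogeneous [OF f(3)])
      moreover have "(graded_part A c g - Poly_Mapping.single w a) * f \<in> J" using wa(2) sub by blast
      ultimately have "graded_part A c g * f - (graded_part A c g - Poly_Mapping.single w a) * f \<in> J"
        by (rule ideals.subspace_diff [OF J])
      then have "Poly_Mapping.single w a * f \<in> J" by (simp add: algebra_simps)
      then have "Poly_Mapping.single 0 (inverse a) * (Poly_Mapping.single w a * f) \<in> J"
        by (rule ideals.subspace_scale [OF J])
      then have "xpow w * f \<in> J"
        using a by (simp add: mult.assoc [symmetric] mult_single xpow_def)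
      then show False using monomial_notin wa(1) a by blast
    qed
    then show "graded_part A c g \<in> face_prime A \<sigma>" using wa(2) by simp
  qed
  with sub have "face_prime A \<sigma> = {g. g * f \<in> J}" by blast
  then show ?thesis
    using closed \<open>\<beta> \<subseteq> \<sigma>\<close> \<open>\<sigma> \<noteq> UNIV\<close> unfolding J_def I_def by blast
qed

section \<open>Associated primes of the circuit ideal\<close>

lemma associated_prime_if_colon:
  assumes "balanced A \<sigma>" "face_prime A \<sigma> = {g. g * f \<in> I}"
  shows "associated_prime pring I (face_prime A \<sigma> :: ('n::finite, 'k::field) mpol set)"
  unfolding associated_prime_def
proof (intro conjI bexI [of _ f])
  show "primeideal (face_prime A \<sigma> :: ('n, 'k) mpol set) pring"
    by (rule face_prime_is_prime [OF assms(1)])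
qed (simp_all add: assms(2) ring_of_type_algebra_def)

lemma balanced_UNIV: "balanced A UNIV"
  by (simp add: balanced_def)

lemma xpow_notin_toric_ideal: "xpow u \<notin> (toric_ideal A :: ('n::finite, 'k::field) mpol set)"
proof -
  have "face_map A UNIV (xpow u :: ('n, 'k) mpol) \<noteq> 0"
    by (metis face_map_xpow top_greatest lookup_single_eq lookup_zero zero_neq_one)
  then show ?thesis
    using face_prime_eq_kernel [OF balanced_UNIV, of A] unfolding face_prime_UNIV by auto
qed

text \<open>
  Passes from an annihilator modulo the saturation to one modulo the circuit ideal itself, where a
  single monomial multiple of \<open>f\<close> has to work for the whole face prime.
\<close>
lemma ex_uniform_exponent_face_prime:
  assumes "face_prime A \<sigma> \<subseteq> {g. g * f \<in> saturation \<beta> (circuit_ideal A :: ('n::finite, 'k::field) mpol set)}"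
  shows "\<exists>m. supp m \<subseteq> \<beta> \<and> (\<forall>g\<in>face_prime A \<sigma>. g * (xpow m * f) \<in> circuit_ideal A)"
proof -
  define I where "I = {g. g * f \<in> (circuit_ideal A :: ('n, 'k) mpol set)}"
  have I: "ideals.subspace I"
    unfolding I_def by (rule subspace_colon) (simp add: circuit_ideal_eq_span)
  obtain Y where Y: "finite Y" "Y \<subseteq> face_prime A \<sigma>" "face_prime A \<sigma> \<subseteq> ideals.span (Y :: ('n, 'k) mpol set)"
    using face_prime_finitely_generated [of A \<sigma>] by blast
  have "Y \<subseteq> saturation \<beta> I"
  proof
    fix y assume "y \<in> Y"
    then have "y * f \<in> saturation \<beta> (circuit_ideal A)" using Y(2) assms by blast
    then show "y \<in> saturation \<beta> I" by (simp add: saturation_def I_def mult.assoc)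
  qed
  from uniform_saturation_exponent [OF I Y(1) this] obtain m
    where "supp m \<subseteq> \<beta>" "\<forall>g\<in>ideals.span Y. xpow m * g \<in> I" by blast
  then show ?thesis using Y(3) by (intro exI [of _ m]) (auto simp: I_def mult_ac)
qed

text \<open>
  Some monomial multiplies the whole toric ideal into the circuit ideal; conversely, the toric ideal is
  prime and contains no monomial, so nothing else is multiplied into the circuit ideal.
\<close>
lemma associated_prime_toric_ideal:
  "associated_prime pring (circuit_ideal A) (toric_ideal A :: ('n::finite, 'k::field) mpol set)"
proof -
  obtain m where m: "\<forall>g\<in>toric_ideal A. g * xpow m \<in> (circuit_ideal A :: ('n, 'k) mpol set)"
    using ex_uniform_exponent_face_prime [of A UNIV 1 UNIV] toric_ideal_subset_saturation_UNIV [of A]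
    by (auto simp: face_prime_UNIV)
  have "g \<in> toric_ideal A" if "g * xpow m \<in> circuit_ideal A" for g :: "('n, 'k) mpol"
  proof -
    have "g * xpow m \<in> toric_ideal A" using that circuit_ideal_subset_toric_ideal by blast
    then show ?thesis
      using primeideal.I_prime [OF face_prime_is_prime [OF balanced_UNIV], of g "xpow m" A]
        xpow_notin_toric_ideal [of m A]
      by (auto simp: face_prime_UNIV ring_of_type_algebra_def)
  qed
  with m have "face_prime A UNIV = {g :: ('n, 'k) mpol. g * xpow m \<in> circuit_ideal A}"
    by (auto simp: face_prime_UNIV)
  from associated_prime_if_colon [OF balanced_UNIV this] show ?thesis by (simp add: face_prime_UNIV)
qed

theorem theorem4p5:
  fixes A :: "int ^ 'n ^ 'd" and \<omega> :: "real ^ 'n" and \<beta> :: "'n set"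
  assumes "rank (real_mat A) = CARD('d)"
    and "ker_lattice A \<inter> {u. \<forall>i. u $ i \<ge> 0} = {0}"
    and "generic_weight TYPE('k::alg_closed_field) A \<omega>"
    and "\<exists>u. csp TYPE('k) A \<omega> u \<beta>"
  shows "\<exists>\<sigma>. cone_face A \<sigma> \<and> \<beta> \<subseteq> \<sigma> \<and>
    embedded_prime pring (circuit_ideal A :: ('n, 'k) mpol set)
      (var_prime \<sigma> <+>\<^bsub>pring\<^esub> toric_ideal A)"
proof -
  define J where "J = saturation \<beta> (circuit_ideal A :: ('n, 'k) mpol set)"
  obtain \<sigma> f where \<sigma>: "circuit_closed A \<sigma>" "\<beta> \<subseteq> \<sigma>" "\<sigma> \<noteq> UNIV"
    and colon: "face_prime A \<sigma> = {g. g * f \<in> J}"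
    using assms(4) toric_ideal_not_in_saturation_if_csp ex_saturated_colon_eq_face_prime
    unfolding J_def by blast
  obtain m where m: "supp m \<subseteq> \<beta>" "\<forall>g\<in>face_prime A \<sigma>. g * (xpow m * f) \<in> circuit_ideal A"
    using ex_uniform_exponent_face_prime [of A \<sigma> f \<beta>] colon unfolding J_def by blast
  have "g \<in> face_prime A \<sigma>" if "g * (xpow m * f) \<in> circuit_ideal A" for g
  proof -
    have "xpow m * (g * f) \<in> J"
      using that subset_saturation [of "circuit_ideal A" \<beta>] by (auto simp: J_def mult_ac)
    then have "g * f \<in> J" unfolding J_def by (rule saturation_cancel [OF m(1)])
    then show ?thesis using colon by blast
  qed
  with m(2) have "face_prime A \<sigma> = {g. g * (xpow m * f) \<in> circuit_ideal A}" by blast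
  then have assoc: "associated_prime pring (circuit_ideal A) (face_prime A \<sigma> :: ('n, 'k) mpol set)"
    using circuit_closed_imp_balanced [OF \<sigma>(1)] by (intro associated_prime_if_colon)
  obtain j where "j \<notin> \<sigma>" using \<sigma>(3) by blast
  then have "(xpow (axis j 1) :: ('n, 'k) mpol) \<in> face_prime A \<sigma>" by (intro xpow_in_face_prime) simp
  then have "toric_ideal A \<subset> (face_prime A \<sigma> :: ('n, 'k) mpol set)"
    using toric_ideal_subset_face_prime xpow_notin_toric_ideal by blast
  then have "embedded_prime pring (circuit_ideal A) (face_prime A \<sigma> :: ('n, 'k) mpol set)"
    unfolding embedded_prime_def using assoc associated_prime_toric_ideal by blast
  then show ?thesis
    using circuit_closed_imp_cone_face [OF \<sigma>(1)] \<sigma>(2) by (auto simp: var_prime_plus_toric_ideal)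
qed

end
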